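(* Let $\mathcal T$ be a triangulation of a surface $S$ of topological type $(g,n)$ and let $\Theta:E\to[0,\pi)$ satisfy condition $\mathbf{(C1)}$. In Euclidean background geometry, the curvature map $Th:\mathbb R_+^{|V|}\to\mathbb R^{|V|}$ is injective up to scalings (i.e. $Th(r)=Th(r')$ implies $r'=cr$ for some $c>0$), and its image consists exactly of the vectors $(K_1,\dots,K_{|V|})$ satisfying $K_i<2\pi$ for $v_i\in V\setminus V_\partial$ and $K_i<\pi$ for $v_i\in V_\partial$, and, for every non-empty subset $A\subseteq V$, $$\sum_{v_i\in A}K_i\ge-\sum_{(e,v)\in Lk(A)}(\pi-\Theta(e))+2\pi\chi(G(A)\setminus\partial S)+\pi\chi(G(A)\cap\partial S),$$ with equality if and only if $A=V$.
   Context: $S$ is a compact oriented surface of genus $g$ whose boundary consists of $n\ge0$ disjoint simple closed curves. $\mathcal T$ has vertex set $V=\{v_1,\dots,v_{|V|}\}$, edge set $E$, triangle set $F$; $V_\partial$ is the set of boundary vertices. Condition $\mathbf{(C1)}$: whenever edges $e_1,e_2,e_3$ bound a triangle, $I(e_1)+I(e_2)I(e_3)\ge0$, $I(e_2)+I(e_3)I(e_1)\ge0$, $I(e_3)+I(e_1)I(e_2)\ge0$ with $I(e)=\cos\Theta(e)$. Curvature map (Euclidean): for $r\in\mathbb R_+^{|V|}$, each triangle $v_iv_jv_k$ is realized as the Euclidean triangle with side lengths $l_{ij}=\sqrt{r_i^2+r_j^2+2r_ir_j\cos\Theta([v_i,v_j])}$ and similarly $l_{jk},l_{ki}$ (valid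 triangles under $\mathbf{(C1)}$); gluing gives a Euclidean cone metric on $S$. $\sigma(v_i)$ is the sum of inner angles at $v_i$ of incident triangles; $K_i=2\pi-\sigma(v_i)$ for interior vertices, $K_i=\pi-\sigma(v_i)$ for boundary vertices; $Th(r)=(K_1,\dots,K_{|V|})$. For non-empty $A\subseteq V$: $G(A)$ is the union of the open cells of $\mathcal T$ having at least one vertex in $A$; for a union $X$ of open cells, $\chi(X)$ = #0-cells − #1-cells + #2-cells in $X$. $Lk(A)$ is the set of pairs $(e,v)$ with $v\in A$, $e\in E$ having no endpoint in $A$, and $e,v$ forming a triangle of $\mathcal T$. *)

theory Defs
  imports Complex_Main
begin

text \<open>Combinatorial model: a triangulation is given by a finite vertex set V
  and a set F of triangles, each a 3-element subset of V (simplicial triangulation).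
  Edges are the 2-element subsets of triangles.\<close>

definition edges :: "'v set set \<Rightarrow> 'v set set" where
  "edges F = {e. card e = 2 \<and> (\<exists>t\<in>F. e \<subseteq> t)}"

definition bdry_edges :: "'v set set \<Rightarrow> 'v set set" where
  "bdry_edges F = {e \<in> edges F. card {t \<in> F. e \<subseteq> t} = 1}"

definition bdry_verts :: "'v set set \<Rightarrow> 'v set" where
  "bdry_verts F = \<Union>(bdry_edges F)"

definition link_verts :: "'v set set \<Rightarrow> 'v \<Rightarrow> 'v set" where
  "link_verts F v = \<Union>{t - {v} | t. t \<in> F \<and> v \<in> t}"

definition link_adj :: "'v set set \<Rightarrow> 'v \<Rightarrow> 'v \<Rightarrow> 'v \<Rightarrow> bool" where
  "link_adj F v x y \<longleftrightarrow> {v, x, y} \<in> F \<and> x \<noteq> y \<and> x \<noteq> v \<and> y \<noteq> v"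

text \<open>Orientation: each triangle gets a cyclic order (a 3-cycle on its vertices),
  and no oriented edge occurs in two distinct triangles.\<close>
definition orientable_tri :: "'v set set \<Rightarrow> bool" where
  "orientable_tri F \<longleftrightarrow> (\<exists>nxt :: 'v set \<Rightarrow> 'v \<Rightarrow> 'v.
     (\<forall>t\<in>F. \<forall>a\<in>t. nxt t a \<in> t \<and> nxt t a \<noteq> a \<and> nxt t (nxt t (nxt t a)) = a) \<and>
     (\<forall>t\<in>F. \<forall>t'\<in>F. \<forall>a. a \<in> t \<longrightarrow> a \<in> t' \<longrightarrow> nxt t a = nxt t' a \<longrightarrow> t = t'))"

definition surface_triangulation :: "'v set \<Rightarrow> 'v set set \<Rightarrow> bool" where
  "surface_triangulation V F \<longleftrightarrow>
     finite V \<and> F \<noteq> {} \<and> (\<forall>t\<in>F. t \<subseteq> V \<and> card t = 3) \<and> V = \<Union>F \<and>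
     (\<forall>e\<in>edges F. card {t \<in> F. e \<subseteq> t} \<in> {1, 2}) \<and>
     (\<forall>v\<in>V. \<forall>a\<in>link_verts F v. \<forall>b\<in>link_verts F v. (link_adj F v)\<^sup>*\<^sup>* a b) \<and>
     (\<forall>a\<in>V. \<forall>b\<in>V. (\<lambda>x y. {x, y} \<in> edges F)\<^sup>*\<^sup>* a b) \<and>
     orientable_tri F"

definition cond_C1 :: "'v set set \<Rightarrow> ('v set \<Rightarrow> real) \<Rightarrow> bool" where
  "cond_C1 F \<Theta> \<longleftrightarrow> (\<forall>t\<in>F. \<forall>a b c. t = {a, b, c} \<longrightarrow>
     cos (\<Theta> {a, b}) + cos (\<Theta> {b, c}) * cos (\<Theta> {c, a}) \<ge> 0)"

definition elen :: "('v set \<Rightarrow> real) \<Rightarrow> ('v \<Rightarrow> real) \<Rightarrow> 'v \<Rightarrow> 'v \<Rightarrow> real" where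
  "elen \<Theta> r a b = sqrt ((r a)\<^sup>2 + (r b)\<^sup>2 + 2 * r a * r b * cos (\<Theta> {a, b}))"

definition eangle :: "('v set \<Rightarrow> real) \<Rightarrow> ('v \<Rightarrow> real) \<Rightarrow> 'v \<Rightarrow> 'v \<Rightarrow> 'v \<Rightarrow> real" where
  "eangle \<Theta> r v a b = arccos (((elen \<Theta> r v a)\<^sup>2 + (elen \<Theta> r v b)\<^sup>2 - (elen \<Theta> r a b)\<^sup>2)
                                / (2 * elen \<Theta> r v a * elen \<Theta> r v b))"

definition tri_angle :: "('v set \<Rightarrow> real) \<Rightarrow> ('v \<Rightarrow> real) \<Rightarrow> 'v set \<Rightarrow> 'v \<Rightarrow> real" where
  "tri_angle \<Theta> r t v =
     (let p = (SOME p. fst p \<noteq> snd p \<and> t = {v, fst p, snd p}) in eangle \<Theta> r v (fst p) (snd p))"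

definition cone_angle :: "'v set set \<Rightarrow> ('v set \<Rightarrow> real) \<Rightarrow> ('v \<Rightarrow> real) \<Rightarrow> 'v \<Rightarrow> real" where
  "cone_angle F \<Theta> r v = (\<Sum>t\<in>{t\<in>F. v \<in> t}. tri_angle \<Theta> r t v)"

definition Th :: "'v set set \<Rightarrow> ('v set \<Rightarrow> real) \<Rightarrow> ('v \<Rightarrow> real) \<Rightarrow> 'v \<Rightarrow> real" where
  "Th F \<Theta> r v = (if v \<in> bdry_verts F then pi else 2 * pi) - cone_angle F \<Theta> r v"

definition chi_int :: "'v set set \<Rightarrow> 'v set \<Rightarrow> int" where
  "chi_int F A = int (card (A - bdry_verts F))
     - int (card {e \<in> edges F - bdry_edges F. e \<inter> A \<noteq> {}})
     + int (card {t \<in> F. t \<inter> A \<noteq> {}})"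

definition chi_bdry :: "'v set set \<Rightarrow> 'v set \<Rightarrow> int" where
  "chi_bdry F A = int (card (A \<inter> bdry_verts F))
     - int (card {e \<in> bdry_edges F. e \<inter> A \<noteq> {}})"

definition Lk :: "'v set set \<Rightarrow> 'v set \<Rightarrow> ('v set \<times> 'v) set" where
  "Lk F A = {(e, v). v \<in> A \<and> e \<in> edges F \<and> e \<inter> A = {} \<and> insert v e \<in> F}"

end

(* No variational principle is used, only monotonicity. In a triangle satisfying (C1) the angle at a
   vertex does not decrease when the radius of another vertex grows, so cone angles obey a discrete
   maximum principle; comparing r' with the largest multiple of r that touches it gives rigidity.
   When the radii on a proper subset A shrink to 0, the total cone angle on A increases to a limit
   M(A), which is the combinatorial bound; hence the inequalities are necessary.
   Conversely, if the angles are at most the prescribed ones away from one vertex for some r, then the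
   pointwise infimum of all such r (Perron's method) solves the problem: the bounds keep the infimum
   away from 0. Such an r exists near any solution, so moving the prescribed angles linearly from those of
   r = 1 to the target, the solvable times form a set that is open, and closed by compactness. *)

theory Submission
  imports Defs
begin

section \<open>Cone angles as a monotone system\<close>

text \<open>Under (C1) an angle need not react to every neighbouring radius: it does not along an
  edge of cosine 1 whose triangle has two further cosines with sum 0. Strictness is therefore
  demanded only along a relation \<open>R\<close> that connects the vertices, and strict statements
  are won at a pair leaving a proper subset. Scaling makes one radius free, and since the angles of
  a triangle sum to pi, the total determines any one cone angle from the others; this is why
  Perron's method may leave out one vertex. The value of \<open>M\<close> comes from single
  triangles. When only one vertex shrinks, its angle tends to pi minus the label of the opposite
  edge, which is a \<open>Lk\<close> term; when two or three shrink, their angles together tend to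
  pi or equal it. Counting edges by triangles turns the number of triangles of the second kind into
  the Euler characteristics.\<close>

lemma finite_convergent_subseq:
  fixes f :: "nat \<Rightarrow> 'v \<Rightarrow> real"
  assumes "finite V" "\<And>n v. v \<in> V \<Longrightarrow> \<bar>f n v\<bar> \<le> B"
  shows "\<exists>\<phi> l. strict_mono (\<phi> :: nat \<Rightarrow> nat) \<and> (\<forall>v\<in>V. (\<lambda>n. f (\<phi> n) v) \<longlonglongrightarrow> l v)"
  using assms
proof (induction V)
  case empty
  show ?case by (rule exI[of _ id]) (simp add: strict_mono_def)
next
  case (insert w W)
  then obtain \<phi> l where \<phi>: "strict_mono (\<phi> :: nat \<Rightarrow> nat)" "\<forall>v\<in>W. (\<lambda>n. f (\<phi> n) v) \<longlonglongrightarrow> l v"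
    by auto
  obtain \<psi> where \<psi>: "strict_mono (\<psi> :: nat \<Rightarrow> nat)" "monoseq (\<lambda>n. f (\<phi> (\<psi> n)) w)"
    using seq_monosub[of "\<lambda>n. f (\<phi> n) w"] by (auto simp: o_def)
  have "Bseq (\<lambda>n. f (\<phi> (\<psi> n)) w)"
    by (rule BseqI'[of _ B]) (use insert.prems in auto)
  then have "convergent (\<lambda>n. f (\<phi> (\<psi> n)) w)"
    using \<psi>(2) by (rule Bseq_monoseq_convergent)
  then obtain x where x: "(\<lambda>n. f (\<phi> (\<psi> n)) w) \<longlonglongrightarrow> x"
    by (auto simp: convergent_def)
  have "strict_mono (\<phi> \<circ> \<psi>)"
    using \<phi>(1) \<psi>(1) by (rule strict_mono_o)
  moreover have "(\<lambda>n. f ((\<phi> \<circ> \<psi>) n) v) \<longlonglongrightarrow> (l(w := x)) v" if "v \<in> insert w W" for v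
    using that x LIMSEQ_subseq_LIMSEQ[OF _ \<psi>(1), of "\<lambda>n. f (\<phi> n) v" "l v"] \<phi>(2)
    by (auto simp: o_def)
  ultimately show ?case by blast
qed

text \<open>\<open>M A\<close> is the limit of the total angle on \<open>A\<close> as the radii on \<open>A\<close> shrink to \<open>0\<close>;
  \<open>R v w\<close> means that the angle at \<open>v\<close> depends strictly on the radius at \<open>w\<close>.\<close>

locale angle_system =
  fixes V :: "'v set" and \<sigma> :: "('v \<Rightarrow> real) \<Rightarrow> 'v \<Rightarrow> real"
    and M :: "'v set \<Rightarrow> real" and R :: "'v \<Rightarrow> 'v \<Rightarrow> bool"
  assumes finite_V: "finite V" and V_nonempty: "V \<noteq> {}"
    and R_in: "R v w \<Longrightarrow> v \<in> V \<and> w \<in> V" and R_sym: "R v w \<Longrightarrow> R w v"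
    and R_connected: "v \<in> V \<Longrightarrow> w \<in> V \<Longrightarrow> R\<^sup>*\<^sup>* v w"
    and scale: "c > 0 \<Longrightarrow> \<forall>w\<in>V. r w > 0 \<Longrightarrow> v \<in> V \<Longrightarrow> \<sigma> (\<lambda>w. c * r w) v = \<sigma> r v"
    and mono: "\<forall>w\<in>V. r w > 0 \<Longrightarrow> \<forall>w\<in>V. r w \<le> r' w \<Longrightarrow> v \<in> V \<Longrightarrow> r v = r' v \<Longrightarrow> \<sigma> r v \<le> \<sigma> r' v"
    and strict: "\<forall>w\<in>V. r w > 0 \<Longrightarrow> \<forall>w\<in>V. r w \<le> r' w \<Longrightarrow> r v = r' v \<Longrightarrow>
      R v w \<Longrightarrow> r w < r' w \<Longrightarrow> \<sigma> r v < \<sigma> r' v"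
    and total: "\<forall>w\<in>V. r w > 0 \<Longrightarrow> (\<Sum>v\<in>V. \<sigma> r v) = M V"
    and cont: "(\<And>n. \<forall>w\<in>V. \<rho> n w > 0) \<Longrightarrow> \<forall>w\<in>V. (\<lambda>n. \<rho> n w) \<longlonglongrightarrow> r w \<Longrightarrow> \<forall>w\<in>V. r w > 0 \<Longrightarrow>
      v \<in> V \<Longrightarrow> (\<lambda>n. \<sigma> (\<rho> n) v) \<longlonglongrightarrow> \<sigma> r v"
    and degenerate: "(\<And>n. \<forall>w\<in>V. \<rho> n w > 0) \<Longrightarrow> \<forall>w\<in>V. (\<lambda>n. \<rho> n w) \<longlonglongrightarrow> r w \<Longrightarrow>
      A \<subset> V \<Longrightarrow> \<forall>w\<in>A. r w = 0 \<Longrightarrow> \<forall>w\<in>V - A. r w > 0 \<Longrightarrow> (\<lambda>n. \<Sum>v\<in>A. \<sigma> (\<rho> n) v) \<longlonglongrightarrow> M A"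
begin

section \<open>Connectedness, rigidity and the necessary inequalities\<close>

abbreviation pos :: "('v \<Rightarrow> real) \<Rightarrow> bool" where "pos r \<equiv> \<forall>w\<in>V. r w > 0"

text \<open>Connectedness enters only in this form: some strict dependence leaves every proper
  non-empty set of vertices, so a weak inequality becomes strict across its border.\<close>

lemma R_exit:
  assumes "X \<subset> V" "X \<noteq> {}"
  shows "\<exists>a b. a \<in> X \<and> b \<in> V - X \<and> R a b"
proof (rule ccontr)
  assume *: "\<not> ?thesis"
  obtain x y where xy: "x \<in> X" "y \<in> V" "y \<notin> X" using assms by auto
  have "z \<in> X" if "R\<^sup>*\<^sup>* x z" for z
    using that by (induction) (use * xy R_in in auto)
  then show False using R_connected[of x y] xy assms by auto
qed

theorem rigidity:
  assumes "pos r" "pos r'" "\<forall>v\<in>V. \<sigma> r v = \<sigma> r' v"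
  shows "\<exists>c>0. \<forall>v\<in>V. r' v = c * r v"
proof -
  define c where "c = Max ((\<lambda>v. r' v / r v) ` V)"
  have "c \<in> (\<lambda>v. r' v / r v) ` V"
    unfolding c_def by (rule Max_in) (use finite_V V_nonempty in auto)
  then obtain v0 where v0: "v0 \<in> V" "c = r' v0 / r v0" by auto
  have c: "c > 0" using v0 assms by auto
  have le: "\<forall>v\<in>V. r' v \<le> c * r v"
  proof
    fix v assume v: "v \<in> V"
    have "r' v / r v \<le> c" unfolding c_def by (rule Max_ge) (use finite_V v in auto)
    then show "r' v \<le> c * r v" using v assms by (simp add: divide_le_eq)
  qed
  \<comment> \<open>\<open>X\<close> is the contact set. At a pair \<open>R a b\<close> leaving it,
    the gap at \<open>b\<close> would make the angle of \<open>r'\<close> at \<open>a\<close>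
    smaller than that of the multiple, which scaling leaves equal to the angle of
    \<open>r\<close>.\<close>
  define X where "X = {v\<in>V. r' v = c * r v}"
  have "X = V"
  proof (rule ccontr)
    assume "X \<noteq> V"
    moreover have "v0 \<in> X" using v0 assms by (auto simp: X_def less_imp_neq)
    ultimately obtain a b where ab: "a \<in> X" "b \<in> V - X" "R a b"
      using R_exit[of X] by (auto simp: X_def)
    have "r' b < c * r b" using ab le by (force simp: X_def less_eq_real_def)
    then have "\<sigma> r' a < \<sigma> (\<lambda>w. c * r w) a"
      using le ab assms(2) by (intro strict[of _ _ _ b]) (auto simp: X_def)
    then show False using scale[OF c assms(1), of a] assms(3) ab by (auto simp: X_def)
  qed
  then show ?thesis using c by (auto simp: X_def)
qed

lemma sum_less_M:
  assumes "pos r" "A \<subset> V" "A \<noteq> {}"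
  shows "(\<Sum>v\<in>A. \<sigma> r v) < M A"
proof -
  \<comment> \<open>Enlarging the radii off \<open>A\<close> amounts to shrinking those on
    \<open>A\<close>, after the rescaling \<open>h\<close>. The index is shifted so that
    \<open>g 0\<close> is \<open>r\<close> itself.\<close>
  define g where "g n = (\<lambda>v. if v \<in> A then r v else real (Suc n) * r v)" for n
  define h where "h n = (\<lambda>v. inverse (real (Suc n)) * g n v)" for n
  have g: "pos (g n)" for n using assms(1) by (auto simp: g_def)
  have fin: "finite A" using assms finite_V finite_subset by blast
  have "(\<lambda>n. \<Sum>v\<in>A. \<sigma> (h n) v) \<longlonglongrightarrow> M A"
  proof (rule degenerate[where r = "\<lambda>v. if v \<in> A then 0 else r v"])
    show "pos (h n)" for n using g[of n] by (auto simp: h_def)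
    show "\<forall>w\<in>V. (\<lambda>n. h n w) \<longlonglongrightarrow> (if w \<in> A then 0 else r w)"
    proof
      fix w
      have "(\<lambda>n. inverse (real (Suc n)) * r w) \<longlonglongrightarrow> 0 * r w"
        by (intro tendsto_intros LIMSEQ_inverse_real_of_nat)
      then have "(\<lambda>n. h n w) \<longlonglongrightarrow> 0" if "w \<in> A"
        using that by (simp add: h_def g_def)
      moreover have "h n w = r w" if "w \<notin> A" for n
      proof -
        have "inverse (real (Suc n)) * real (Suc n) = 1" by (rule left_inverse) simp
        then show ?thesis using that unfolding h_def g_def by (simp only: if_False mult.assoc[symmetric] mult_1)
      qed
      ultimately show "(\<lambda>n. h n w) \<longlonglongrightarrow> (if w \<in> A then 0 else r w)"
        by auto
    qed
  qed (use assms in auto)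
  moreover have "\<sigma> (h n) v = \<sigma> (g n) v" if "v \<in> A" for n v
    unfolding h_def using scale[OF _ g, of "inverse (real (Suc n))" v n] that assms(2) by auto
  ultimately have lim: "(\<lambda>n. \<Sum>v\<in>A. \<sigma> (g n) v) \<longlonglongrightarrow> M A" by simp
  have gle: "\<forall>w\<in>V. g m w \<le> g n w" if "m \<le> n" for m n
    using that assms(1) by (auto simp: g_def intro!: mult_right_mono less_imp_le)
  have "(\<Sum>v\<in>A. \<sigma> (g 1) v) \<le> M A"
  proof (rule LIMSEQ_le_const[OF lim], intro exI[of _ 1] allI impI sum_mono)
    fix n :: nat and v assume "1 \<le> n" "v \<in> A"
    then show "\<sigma> (g 1) v \<le> \<sigma> (g n) v"
      using assms(2) by (intro mono g gle) (auto simp: g_def)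
  qed
  \<comment> \<open>The first step already gains strictly, at a vertex of \<open>A\<close> with a
    dependence leaving \<open>A\<close>.\<close>
  moreover have "(\<Sum>v\<in>A. \<sigma> (g 0) v) < (\<Sum>v\<in>A. \<sigma> (g 1) v)"
  proof -
    obtain a b where ab: "a \<in> A" "b \<in> V - A" "R a b" using R_exit[OF assms(2,3)] by auto
    have "\<sigma> (g 0) a < \<sigma> (g 1) a"
      using ab assms(1) by (intro strict[of _ _ _ b] g gle) (auto simp: g_def)
    moreover have "\<sigma> (g 0) v \<le> \<sigma> (g 1) v" if "v \<in> A" for v
      using assms(2) that by (intro mono g gle) (auto simp: g_def)
    ultimately show ?thesis using ab fin by (intro sum_strict_mono_ex1) auto
  qed
  moreover have "g 0 = r" by (auto simp: g_def)
  ultimately show ?thesis by simp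
qed

section \<open>Strict supersolutions and Perron's method\<close>

lemma lower_one:
  assumes "pos r" "a \<in> V" "\<sigma> r a < y"
  shows "\<exists>x. 0 < x \<and> x < r a \<and> \<sigma> (r(a := x)) a < y"
proof -
  \<comment> \<open>The denominators start at 2, so that every \<open>x n\<close> is
    positive.\<close>
  define x where "x n = r a - r a * inverse (real (Suc (Suc n)))" for n
  have ra: "r a > 0" using assms by auto
  have "inverse (real (Suc (Suc n))) < 1" for n by (simp add: field_simps)
  then have x: "0 < x n" "x n < r a" for n
    using ra mult_strict_left_mono[of "inverse (real (Suc (Suc n)))" 1 "r a"]
    by (auto simp: x_def)
  have "x \<longlonglongrightarrow> r a - r a * 0" unfolding x_def
    by (intro tendsto_intros LIMSEQ_Suc[OF LIMSEQ_inverse_real_of_nat])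
  then have "(\<lambda>n. (r(a := x n)) w) \<longlonglongrightarrow> r w" for w
    by (cases "w = a") auto
  then have "(\<lambda>n. \<sigma> (r(a := x n)) a) \<longlonglongrightarrow> \<sigma> r a"
    using assms x by (intro cont) auto
  then have "eventually (\<lambda>n. \<sigma> (r(a := x n)) a < y) sequentially"
    using assms(3) by (rule order_tendstoD)
  then show ?thesis using x by (auto simp: eventually_sequentially)
qed

lemma lower_mono:
  assumes "pos r" "a \<in> V" "0 < x" "x < r a" "v \<in> V" "v \<noteq> a"
  shows "\<sigma> (r(a := x)) v \<le> \<sigma> r v"
  using assms by (intro mono) auto

text \<open>Lowering the radius at \<open>v0\<close>, and then slightly at each vertex whose angle has already dropped,
  spreads the strict inequality along \<open>R\<close>.\<close>

lemma strict_supersolution: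
  assumes "pos r" "v0 \<in> V"
  shows "\<exists>r'. pos r' \<and> (\<forall>v\<in>V - {v0}. \<sigma> r' v < \<sigma> r v)"
proof -
  define P where "P W \<longleftrightarrow> W \<subseteq> V - {v0} \<and> (\<exists>r'. pos r' \<and> (\<forall>v\<in>V - {v0}. \<sigma> r' v \<le> \<sigma> r v) \<and>
    (\<forall>v\<in>W. \<sigma> r' v < \<sigma> r v))" for W
  have "P {}" using assms by (auto simp: P_def)
  moreover have "finite {W. P W}"
    by (rule finite_subset[of _ "Pow V"]) (use finite_V in \<open>auto simp: P_def\<close>)
  ultimately obtain W where W: "P W" and max: "\<And>W'. P W' \<Longrightarrow> W \<subseteq> W' \<Longrightarrow> W = W'"
    using finite_has_maximal[of "{W. P W}"] by auto
  then obtain r' where r': "pos r'" "\<forall>v\<in>V - {v0}. \<sigma> r' v \<le> \<sigma> r v" "\<forall>v\<in>W. \<sigma> r' v < \<sigma> r v"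
    and sub: "W \<subseteq> V - {v0}"
    by (auto simp: P_def)
  have "W = V - {v0}"
  proof (rule ccontr)
    assume "W \<noteq> V - {v0}"
    then have "insert v0 W \<subset> V" using sub assms by auto
    then obtain a b where ab: "a \<in> insert v0 W" "b \<in> V - insert v0 W" "R a b"
      using R_exit[of "insert v0 W"] by auto
    have aV: "a \<in> V" using ab R_in by auto
    \<comment> \<open>At \<open>v0\<close> nothing has to be preserved, so any bound above the
      current angle will do; elsewhere the gap already won limits the decrease.\<close>
    define y where "y = (if a = v0 then \<sigma> r' a + 1 else \<sigma> r a)"
    have "\<sigma> r' a < y" using ab r'(3) by (auto simp: y_def)
    then obtain x where x: "0 < x" "x < r' a" "\<sigma> (r'(a := x)) a < y"
      using lower_one[OF r'(1) aV] by blast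
    have "b \<noteq> a" using ab by auto
    then have b: "\<sigma> (r'(a := x)) b < \<sigma> r' b"
      using x r'(1) ab(3) by (intro strict[of _ _ _ a]) (auto intro: R_sym)
    have "\<sigma> (r'(a := x)) v \<le> \<sigma> r v \<and> (v \<in> insert b W \<longrightarrow> \<sigma> (r'(a := x)) v < \<sigma> r v)"
      if v: "v \<in> V - {v0}" for v
    proof (cases "v = a")
      case True
      then show ?thesis using x v by (auto simp: y_def)
    next
      case False
      then have "\<sigma> (r'(a := x)) v \<le> \<sigma> r' v" "\<sigma> r' v \<le> \<sigma> r v"
        using lower_mono[OF r'(1) aV x(1,2)] r'(2) v by auto
      moreover have "\<sigma> r' v < \<sigma> r v" if "v \<in> W" using r'(3) that by auto
      moreover have "\<sigma> (r'(a := x)) v < \<sigma> r' v" if "v = b" using b that by simp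
      ultimately show ?thesis by fastforce
    qed
    moreover have "pos (r'(a := x))" using r'(1) x by auto
    moreover have "insert b W \<subseteq> V - {v0}" using sub ab by auto
    ultimately have "P (insert b W)" unfolding P_def by blast
    then show False using max[of "insert b W"] ab by auto
  qed
  then show ?thesis using r' by auto
qed


text \<open>Minima of supersolutions are supersolutions, because at a vertex where one of them
  attains the minimum the other radii only drop. Fixing the radius at \<open>v0\<close> removes the
  scaling freedom, which would otherwise drive the infimum to 0.\<close>

lemma perron:
  assumes "v0 \<in> V" "pos r0" "\<forall>v\<in>V - {v0}. \<sigma> r0 v \<le> s v"
    and sum_s: "(\<Sum>v\<in>V. s v) = M V" and less_M: "\<And>A. A \<subset> V \<Longrightarrow> A \<noteq> {} \<Longrightarrow> (\<Sum>v\<in>A. s v) < M A"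
  shows "\<exists>r. pos r \<and> (\<forall>v\<in>V. \<sigma> r v = s v)"
proof -
  define S where "S = {r. pos r \<and> r v0 = r0 v0 \<and> (\<forall>v\<in>V - {v0}. \<sigma> r v \<le> s v)}"
  define i where "i v = Inf ((\<lambda>r. r v) ` S)" for v
  have S0: "r0 \<in> S" using assms by (auto simp: S_def)
  have bdd: "bdd_below ((\<lambda>r. r v) ` S)" if "v \<in> V" for v
    by (rule bdd_belowI[of _ 0]) (use that in \<open>auto simp: S_def less_imp_le\<close>)
  have i_le: "i v \<le> r v" if "v \<in> V" "r \<in> S" for v r
    unfolding i_def using that bdd by (intro cInf_lower) auto
  have i_ge: "i v \<ge> 0" if "v \<in> V" for v
    unfolding i_def using that S0 by (intro cInf_greatest) (auto simp: S_def less_imp_le)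
  have ex: "\<exists>q. q \<in> S \<and> (v \<in> V \<longrightarrow> q v < i v + inverse (real (Suc n)))" for v n
  proof (cases "v \<in> V")
    case True
    have "Inf ((\<lambda>r. r v) ` S) < i v + inverse (real (Suc n))" by (simp add: i_def)
    then show ?thesis using cInf_less_iff[OF _ bdd[OF True]] S0 by fastforce
  qed (use S0 in auto)
  define q where "q n v = (SOME q. q \<in> S \<and> (v \<in> V \<longrightarrow> q v < i v + inverse (real (Suc n))))" for n v
  have q: "q n v \<in> S" and q_less: "v \<in> V \<Longrightarrow> q n v v < i v + inverse (real (Suc n))" for n v
    using someI_ex[OF ex[of v n]] unfolding q_def by blast+
  \<comment> \<open>A single vector has to be near the infimum at all vertices at once; the minimum
    over \<open>v\<close> of the vectors \<open>q n v\<close>, each nearly minimal at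
    \<open>v\<close>, is one.\<close>
  define \<rho> where "\<rho> n w = Min ((\<lambda>v. q n v w) ` V)" for n w
  have \<rho>_le: "\<rho> n w \<le> q n v w" if "v \<in> V" for n v w
    unfolding \<rho>_def using that finite_V by (intro Min_le) auto
  have \<rho>_eq: "\<exists>v\<in>V. \<rho> n w = q n v w" for n w
  proof -
    have "\<rho> n w \<in> (\<lambda>v. q n v w) ` V"
      unfolding \<rho>_def using finite_V V_nonempty by (intro Min_in) auto
    then show ?thesis by auto
  qed
  have \<rho>_pos: "pos (\<rho> n)" for n
  proof
    fix w assume "w \<in> V"
    moreover obtain v where "\<rho> n w = q n v w" using \<rho>_eq by auto
    ultimately show "\<rho> n w > 0" using q[of n v] by (auto simp: S_def)
  qed
  have "\<sigma> (\<rho> n) w \<le> s w" if "w \<in> V - {v0}" for n w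
  proof -
    obtain v where v: "v \<in> V" "\<rho> n w = q n v w" using \<rho>_eq by auto
    then have "\<sigma> (\<rho> n) w \<le> \<sigma> (q n v) w"
      using \<rho>_pos \<rho>_le that by (intro mono) auto
    also have "\<dots> \<le> s w" using q[of n v] that by (auto simp: S_def)
    finally show ?thesis .
  qed
  moreover have "\<rho> n v0 = r0 v0" for n
  proof -
    obtain v where "\<rho> n v0 = q n v v0" using \<rho>_eq by auto
    then show ?thesis using q[of n v] by (simp add: S_def)
  qed
  ultimately have \<rho>_S: "\<rho> n \<in> S" for n using \<rho>_pos by (auto simp: S_def)
  have lim: "(\<lambda>n. \<rho> n w) \<longlonglongrightarrow> i w" if "w \<in> V" for w
  proof (rule tendsto_sandwich)
    show "eventually (\<lambda>n. i w \<le> \<rho> n w) sequentially" using i_le[OF that \<rho>_S] by simp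
    show "eventually (\<lambda>n. \<rho> n w \<le> i w + inverse (real (Suc n))) sequentially"
      using order.trans[OF \<rho>_le[OF that] less_imp_le[OF q_less[OF that]]] by simp
    have "(\<lambda>n. i w + inverse (real (Suc n))) \<longlonglongrightarrow> i w + 0"
      by (intro tendsto_intros LIMSEQ_inverse_real_of_nat)
    then show "(\<lambda>n. i w + inverse (real (Suc n))) \<longlonglongrightarrow> i w" by simp
  qed simp
  have i_v0: "i v0 = r0 v0"
    using LIMSEQ_unique[OF lim[OF assms(1)], of "r0 v0"] \<rho>_S by (auto simp: S_def)
  \<comment> \<open>Where the infimum vanishes, the angle sums of \<open>\<rho> n\<close> tend to
    \<open>M A\<close>, yet they stay below the strictly smaller sum of \<open>s\<close>. The
    normalisation keeps \<open>v0\<close> out of \<open>A\<close>.\<close>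
  define A where "A = {v \<in> V. i v = 0}"
  have "v0 \<notin> A" using assms(1,2) i_v0 by (auto simp: A_def)
  then have A: "A \<subset> V" using assms(1) by (auto simp: A_def)
  have "A = {}"
  proof (rule ccontr)
    assume "A \<noteq> {}"
    have "(\<lambda>n. \<Sum>v\<in>A. \<sigma> (\<rho> n) v) \<longlonglongrightarrow> M A"
      using \<rho>_pos lim A i_ge by (intro degenerate) (auto simp: A_def less_eq_real_def)
    moreover have "(\<Sum>v\<in>A. \<sigma> (\<rho> n) v) \<le> (\<Sum>v\<in>A. s v)" for n
      using \<rho>_S[of n] A \<open>v0 \<notin> A\<close> by (intro sum_mono) (auto simp: S_def)
    ultimately have "M A \<le> (\<Sum>v\<in>A. s v)" by (intro LIMSEQ_le_const2) auto
    then show False using less_M[OF A \<open>A \<noteq> {}\<close>] by simp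
  qed
  then have i_pos: "pos i" using i_ge by (force simp: A_def less_eq_real_def)
  have i_sup: "\<sigma> i v \<le> s v" if "v \<in> V - {v0}" for v
  proof (rule LIMSEQ_le_const2)
    show "(\<lambda>n. \<sigma> (\<rho> n) v) \<longlonglongrightarrow> \<sigma> i v"
      using \<rho>_pos lim i_pos that by (intro cont) auto
  qed (use \<rho>_S that in \<open>auto simp: S_def\<close>)
  have i_eq: "\<sigma> i v = s v" if v: "v \<in> V - {v0}" for v
  proof (rule ccontr)
    assume "\<sigma> i v \<noteq> s v"
    \<comment> \<open>Room at \<open>v\<close> would permit a smaller radius there without raising
      the other angles: a supersolution below the infimum.\<close>
    then have "\<sigma> i v < s v" using i_sup[OF v] by simp
    then obtain x where x: "0 < x" "x < i v" "\<sigma> (i(v := x)) v < s v"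
      using lower_one[OF i_pos] v by blast
    have "\<sigma> (i(v := x)) w \<le> s w" if "w \<in> V - {v0}" for w
    proof (cases "w = v")
      case False
      then show ?thesis
        using order.trans[OF lower_mono[OF i_pos _ x(1,2), of w] i_sup[OF that]] v that by simp
    qed (use x in simp)
    then have "i(v := x) \<in> S" using x v i_pos i_v0 by (auto simp: S_def)
    then show False using i_le[of v "i(v := x)"] x v by simp
  qed
  \<comment> \<open>All angles off \<open>v0\<close> are now right, and the fixed total settles the
    last one.\<close>
  have "(\<Sum>v\<in>V. \<sigma> i v) = (\<Sum>v\<in>V. s v)" using total[OF i_pos] sum_s by simp
  then have "\<sigma> i v0 = s v0"
    using i_eq by (simp add: sum.remove[OF finite_V assms(1)])
  then show ?thesis using i_pos i_eq by auto
qed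

section \<open>Closedness and openness of solvability, and existence\<close>

lemma solvable_limit:
  assumes "\<And>n. pos (r n)" "\<And>n v. v \<in> V \<Longrightarrow> \<sigma> (r n) v = s n v" "\<forall>v\<in>V. (\<lambda>n. s n v) \<longlonglongrightarrow> s' v"
    and less_M: "\<And>A. A \<subset> V \<Longrightarrow> A \<noteq> {} \<Longrightarrow> (\<Sum>v\<in>A. s' v) < M A"
  shows "\<exists>r. pos r \<and> (\<forall>v\<in>V. \<sigma> r v = s' v)"
proof -
  \<comment> \<open>Dividing by the maximum puts the solutions into a compact cube; it remains to
    exclude radii that vanish in the limit.\<close>
  define m where "m n = Max (r n ` V)" for n
  define f where "f n v = inverse (m n) * r n v" for n v
  have m_ge: "r n v \<le> m n" if "v \<in> V" for n v
    unfolding m_def using that finite_V by (intro Max_ge) auto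
  have m_in: "\<exists>v\<in>V. m n = r n v" for n
  proof -
    have "m n \<in> r n ` V" unfolding m_def using finite_V V_nonempty by (intro Max_in) auto
    then show ?thesis by auto
  qed
  have m: "m n > 0" for n using m_in[of n] assms(1)[of n] by auto
  have f_pos: "pos (f n)" for n using m assms(1) by (auto simp: f_def)
  have f_le: "f n v \<le> 1" if "v \<in> V" for n v
    using m_ge[OF that, of n] m[of n] by (simp add: f_def field_simps)
  \<comment> \<open>The largest entry is 1. Stated for the sum, this bound passes to the limit at
    once and keeps the limit from being identically 0.\<close>
  have f_sum: "1 \<le> (\<Sum>v\<in>V. f n v)" for n
  proof -
    obtain v where v: "v \<in> V" "m n = r n v" using m_in by auto
    then have "f n v = 1" using m[of n] by (simp add: f_def)
    then show ?thesis using member_le_sum[OF v(1), of "f n"] f_pos[of n] finite_V by (auto simp: less_imp_le)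
  qed
  have \<sigma>_f: "\<sigma> (f n) v = s n v" if "v \<in> V" for n v
    unfolding f_def using scale[OF _ assms(1) that, of "inverse (m n)" n] m assms(2)[OF that] by simp
  have "\<bar>f n v\<bar> \<le> 1" if "v \<in> V" for n v
    using f_pos[of n] f_le[OF that] that by (auto simp: abs_le_iff)
  then obtain \<phi> l where \<phi>: "strict_mono (\<phi> :: nat \<Rightarrow> nat)"
    and l: "\<forall>v\<in>V. (\<lambda>n. f (\<phi> n) v) \<longlonglongrightarrow> l v"
    using finite_convergent_subseq[OF finite_V, of f 1] by auto
  have s_lim: "(\<lambda>n. s (\<phi> n) v) \<longlonglongrightarrow> s' v" if "v \<in> V" for v
    using LIMSEQ_subseq_LIMSEQ[OF _ \<phi>, of "\<lambda>n. s n v" "s' v"] assms(3) that by (auto simp: o_def)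
  have l_ge: "l v \<ge> 0" if "v \<in> V" for v
    using that l f_pos by (intro LIMSEQ_le_const[of "\<lambda>n. f (\<phi> n) v"]) (auto simp: less_imp_le)
  have "(\<lambda>n. \<Sum>v\<in>V. f (\<phi> n) v) \<longlonglongrightarrow> (\<Sum>v\<in>V. l v)" using l by (intro tendsto_sum) auto
  then have "1 \<le> (\<Sum>v\<in>V. l v)" using f_sum by (intro LIMSEQ_le_const) auto
  define A where "A = {v \<in> V. l v = 0}"
  have "A \<noteq> V"
  proof
    assume "A = V"
    then have "(\<Sum>v\<in>V. l v) = 0" by (intro sum.neutral) (auto simp: A_def)
    then show False using \<open>1 \<le> (\<Sum>v\<in>V. l v)\<close> by simp
  qed
  then have A: "A \<subset> V" by (auto simp: A_def)
  have "A = {}"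
  proof (rule ccontr)
    assume "A \<noteq> {}"
    \<comment> \<open>On the zero set \<open>A\<close> the angle sums would converge both to
      \<open>M A\<close> and to the prescribed sum, which is strictly smaller.\<close>
    have "(\<lambda>n. \<Sum>v\<in>A. \<sigma> (f (\<phi> n)) v) \<longlonglongrightarrow> M A"
      using f_pos l A l_ge by (intro degenerate) (auto simp: A_def less_eq_real_def)
    moreover have "(\<lambda>n. \<Sum>v\<in>A. \<sigma> (f (\<phi> n)) v) \<longlonglongrightarrow> (\<Sum>v\<in>A. s' v)"
      using s_lim A by (intro tendsto_sum) (auto simp: \<sigma>_f)
    ultimately have "M A = (\<Sum>v\<in>A. s' v)" by (rule LIMSEQ_unique)
    then show False using less_M[OF A \<open>A \<noteq> {}\<close>] by simp
  qed
  then have l_pos: "pos l" using l_ge by (force simp: A_def less_eq_real_def)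
  have "\<sigma> l v = s' v" if "v \<in> V" for v
  proof (rule LIMSEQ_unique)
    show "(\<lambda>n. \<sigma> (f (\<phi> n)) v) \<longlonglongrightarrow> \<sigma> l v"
      using f_pos l l_pos that by (intro cont) auto
    show "(\<lambda>n. \<sigma> (f (\<phi> n)) v) \<longlonglongrightarrow> s' v"
      using s_lim[OF that] \<sigma>_f[OF that] by simp
  qed
  then show ?thesis using l_pos by auto
qed

text \<open>A strict supersolution leaves a margin off \<open>v0\<close>, so the same radii remain a
  supersolution for all targets close enough to the angles of \<open>r\<close>.\<close>

lemma solvable_open:
  assumes "pos r" "\<And>n. (\<Sum>v\<in>V. s n v) = M V"
    and "\<And>n A. A \<subset> V \<Longrightarrow> A \<noteq> {} \<Longrightarrow> (\<Sum>v\<in>A. s n v) < M A"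
    and lim: "\<And>v. v \<in> V \<Longrightarrow> (\<lambda>n. s n v) \<longlonglongrightarrow> \<sigma> r v"
  shows "\<exists>n r'. pos r' \<and> (\<forall>v\<in>V. \<sigma> r' v = s n v)"
proof -
  obtain v0 where v0: "v0 \<in> V" using V_nonempty by auto
  obtain r' where r': "pos r'" "\<forall>v\<in>V - {v0}. \<sigma> r' v < \<sigma> r v"
    using strict_supersolution[OF assms(1) v0] by auto
  have "eventually (\<lambda>n. \<forall>v\<in>V - {v0}. \<sigma> r' v < s n v) sequentially"
    using r' lim finite_V by (intro eventually_ball_finite ballI order_tendstoD(1)[of _ "\<sigma> r _"]) auto
  then obtain n where "\<forall>v\<in>V - {v0}. \<sigma> r' v < s n v" by (auto simp: eventually_sequentially)
  then show ?thesis using perron[OF v0 r'(1), of "s n"] assms(2,3) by (auto simp: less_imp_le)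
qed

theorem existence:
  assumes sum_s: "(\<Sum>v\<in>V. s v) = M V" and less_M: "\<And>A. A \<subset> V \<Longrightarrow> A \<noteq> {} \<Longrightarrow> (\<Sum>v\<in>A. s v) < M A"
  shows "\<exists>r. pos r \<and> (\<forall>v\<in>V. \<sigma> r v = s v)"
proof -
  \<comment> \<open>Every condition is linear in the target. The conditions hold at
    \<open>t = 1\<close> by assumption and at \<open>t = 0\<close> because the radii 1 realise that
    target, hence on the whole segment.\<close>
  define h where "h t v = (1 - t) * \<sigma> (\<lambda>_. 1) v + t * s v" for t v
  have one: "pos (\<lambda>_. 1)" by simp
  have h_sum: "(\<Sum>v\<in>A. h t v) = (1 - t) * (\<Sum>v\<in>A. \<sigma> (\<lambda>_. 1) v) + t * (\<Sum>v\<in>A. s v)" for t A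
    by (simp add: h_def sum.distrib sum_distrib_left)
  have h_total: "(\<Sum>v\<in>V. h t v) = M V" for t
    using total[OF one] sum_s by (simp add: h_sum algebra_simps)
  have h_less: "(\<Sum>v\<in>A. h t v) < M A" if "0 \<le> t" "t \<le> 1" "A \<subset> V" "A \<noteq> {}" for t A
    unfolding h_sum using that sum_less_M[OF one that(3,4)] less_M[OF that(3,4)]
    by (intro convex_bound_lt) auto
  have h_lim: "(\<lambda>n. h (t n) v) \<longlonglongrightarrow> h t' v" if "t \<longlonglongrightarrow> t'" for t t' v
    unfolding h_def by (intro tendsto_intros that)
  define T where "T = {t \<in> {0..1}. \<exists>r. pos r \<and> (\<forall>v\<in>V. \<sigma> r v = h t v)}"
  have "\<forall>v\<in>V. \<sigma> (\<lambda>_. 1) v = h 0 v" by (simp add: h_def)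
  then have "0 \<in> T" using one unfolding T_def by fastforce
  have bdd: "bdd_above T" by (rule bdd_aboveI[of _ 1]) (auto simp: T_def)
  define \<tau> where "\<tau> = Sup T"
  have T_le: "t \<le> \<tau>" if "t \<in> T" for t unfolding \<tau>_def using that bdd by (rule cSup_upper)
  have "t \<le> 1" if "t \<in> T" for t using that by (simp add: T_def)
  then have "\<tau> \<le> 1" unfolding \<tau>_def using \<open>0 \<in> T\<close> by (intro cSup_least) auto
  moreover have "0 \<le> \<tau>" using T_le[OF \<open>0 \<in> T\<close>] .
  ultimately have \<tau>: "0 \<le> \<tau>" "\<tau> \<le> 1" by simp_all
  have "\<exists>t. t \<in> T \<and> \<tau> - inverse (real (Suc n)) < t" for n
    using less_cSupD[of T "\<tau> - inverse (real (Suc n))"] \<open>0 \<in> T\<close> unfolding \<tau>_def by auto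
  then have "\<forall>n. \<exists>t. t \<in> T \<and> \<tau> - inverse (real (Suc n)) < t" by blast
  then obtain t where "\<forall>n. t n \<in> T \<and> \<tau> - inverse (real (Suc n)) < t n"
    using choice[of "\<lambda>n t. t \<in> T \<and> \<tau> - inverse (real (Suc n)) < t"] by blast
  then have t: "\<And>n. t n \<in> T" "\<And>n. \<tau> - inverse (real (Suc n)) < t n" by blast+
  have "t \<longlonglongrightarrow> \<tau>"
  proof (rule tendsto_sandwich)
    have "(\<lambda>n. \<tau> - inverse (real (Suc n))) \<longlonglongrightarrow> \<tau> - 0"
      by (intro tendsto_intros LIMSEQ_inverse_real_of_nat)
    then show "(\<lambda>n. \<tau> - inverse (real (Suc n))) \<longlonglongrightarrow> \<tau>" by simp
    show "eventually (\<lambda>n. \<tau> - inverse (real (Suc n)) \<le> t n) sequentially"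
      using less_imp_le[OF t(2)] by simp
    show "eventually (\<lambda>n. t n \<le> \<tau>) sequentially" using T_le[OF t(1)] by simp
  qed simp
  then have lim: "\<forall>v\<in>V. (\<lambda>n. h (t n) v) \<longlonglongrightarrow> h \<tau> v" using h_lim by blast
  have "\<forall>n. \<exists>r. pos r \<and> (\<forall>v\<in>V. \<sigma> r v = h (t n) v)" using t(1) by (simp add: T_def)
  then obtain q where q: "\<forall>n. pos (q n) \<and> (\<forall>v\<in>V. \<sigma> (q n) v = h (t n) v)"
    using choice[of "\<lambda>n r. pos r \<and> (\<forall>v\<in>V. \<sigma> r v = h (t n) v)"] by blast
  have "\<exists>r. pos r \<and> (\<forall>v\<in>V. \<sigma> r v = h \<tau> v)"
    by (rule solvable_limit[of q "\<lambda>n. h (t n)"]) (use q lim h_less[OF \<tau>] in auto)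
  then obtain r where r: "pos r" "\<forall>v\<in>V. \<sigma> r v = h \<tau> v" by auto
  have "\<tau> = 1"
  proof (rule ccontr)
    assume "\<tau> \<noteq> 1"
    then have "\<tau> < 1" using \<tau> by simp
    \<comment> \<open>These times decrease from \<open>u 0 = 1\<close> to \<open>\<tau>\<close>;
      openness makes one of them solvable, against the choice of the supremum.\<close>
    define u where "u n = \<tau> + (1 - \<tau>) * inverse (real (Suc n))" for n
    have u: "\<tau> < u n" "u n \<le> 1" for n
      using \<open>\<tau> < 1\<close> mult_left_mono[of "inverse (real (Suc n))" 1 "1 - \<tau>"]
      by (auto simp: u_def field_simps)
    have "u \<longlonglongrightarrow> \<tau> + (1 - \<tau>) * 0" unfolding u_def
      by (intro tendsto_intros LIMSEQ_inverse_real_of_nat)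
    then have "(\<lambda>n. h (u n) v) \<longlonglongrightarrow> \<sigma> r v" if "v \<in> V" for v
      using h_lim[of u \<tau>] r that by simp
    moreover have "0 \<le> u n" for n using u(1)[of n] \<tau> by simp
    ultimately have "\<exists>n r'. pos r' \<and> (\<forall>v\<in>V. \<sigma> r' v = h (u n) v)"
      using h_total h_less u(2) by (intro solvable_open[OF r(1)]) auto
    then obtain n r' where "pos r'" "\<forall>v\<in>V. \<sigma> r' v = h (u n) v" by auto
    then have "u n \<in> T" using u[of n] \<tau> by (auto simp: T_def)
    then show False using T_le[of "u n"] u(1)[of n] by simp
  qed
  then show ?thesis using r by (auto simp: h_def)
qed

theorem image:
  "(\<exists>r. pos r \<and> (\<forall>v\<in>V. \<sigma> r v = s v)) \<longleftrightarrow>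
    (\<Sum>v\<in>V. s v) = M V \<and> (\<forall>A. A \<subset> V \<longrightarrow> A \<noteq> {} \<longrightarrow> (\<Sum>v\<in>A. s v) < M A)"
proof
  assume "\<exists>r. pos r \<and> (\<forall>v\<in>V. \<sigma> r v = s v)"
  then obtain r where r: "pos r" "\<forall>v\<in>V. \<sigma> r v = s v" by auto
  have "(\<Sum>v\<in>A. s v) = (\<Sum>v\<in>A. \<sigma> r v)" if "A \<subseteq> V" for A
    using that r by (intro sum.cong) auto
  then show "(\<Sum>v\<in>V. s v) = M V \<and> (\<forall>A. A \<subset> V \<longrightarrow> A \<noteq> {} \<longrightarrow> (\<Sum>v\<in>A. s v) < M A)"
    using total[OF r(1)] sum_less_M[OF r(1)] by (simp add: psubset_imp_subset)
qed (use existence in auto)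

end

section \<open>Angles of a single triangle\<close>

definition len :: "real \<Rightarrow> real \<Rightarrow> real \<Rightarrow> real" where
  "len x y c = sqrt (x\<^sup>2 + y\<^sup>2 + 2 * x * y * c)"

text \<open>The angle at the vertex of radius \<open>x\<close> in the triangle with radii \<open>x\<close>, \<open>y\<close>, \<open>z\<close>, where
  \<open>a\<close>, \<open>b\<close>, \<open>c\<close> are the cosines attached to the edges opposite to \<open>x\<close>, \<open>y\<close>, \<open>z\<close> respectively.\<close>

definition cosang :: "real \<Rightarrow> real \<Rightarrow> real \<Rightarrow> real \<Rightarrow> real \<Rightarrow> real \<Rightarrow> real" where
  "cosang x y z a b c = (x\<^sup>2 + x * y * c + x * z * b - y * z * a) / (len x y c * len x z b)"

definition ang :: "real \<Rightarrow> real \<Rightarrow> real \<Rightarrow> real \<Rightarrow> real \<Rightarrow> real \<Rightarrow> real" where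
  "ang x y z a b c = arccos (cosang x y z a b c)"

text \<open>The lower bounds -1 are strict because labels are below pi; the last three conditions
  are (C1).\<close>

definition admissible :: "real \<Rightarrow> real \<Rightarrow> real \<Rightarrow> bool" where
  "admissible a b c \<longleftrightarrow> -1 < a \<and> a \<le> 1 \<and> -1 < b \<and> b \<le> 1 \<and> -1 < c \<and> c \<le> 1 \<and>
     a + b * c \<ge> 0 \<and> b + c * a \<ge> 0 \<and> c + a * b \<ge> 0"

text \<open>The expansion is grouped by the combinations that (C1) makes nonnegative, so that its
  sign can be read off term by term.\<close>

definition area :: "real \<Rightarrow> real \<Rightarrow> real \<Rightarrow> real \<Rightarrow> real \<Rightarrow> real \<Rightarrow> real" where
  "area x y z a b c = x\<^sup>2 * y\<^sup>2 * (1 - c\<^sup>2) + x\<^sup>2 * z\<^sup>2 * (1 - b\<^sup>2) + y\<^sup>2 * z\<^sup>2 * (1 - a\<^sup>2)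
     + 2 * x * y * z * (x * (a + b * c) + y * (b + c * a) + z * (c + a * b))"

lemma admissible_rotate: "admissible a b c \<Longrightarrow> admissible b c a"
  and admissible_swap: "admissible a b c \<Longrightarrow> admissible a c b"
  by (simp_all add: admissible_def mult.commute)

section \<open>Symmetries, side lengths and area\<close>

lemma ang_swap: "ang x y z a b c = ang x z y a c b"
  by (simp add: ang_def cosang_def mult_ac add_ac)

lemma area_rotate: "area x y z a b c = area y z x b c a"
  by (simp add: area_def mult_ac add_ac)

lemma len_commute: "len x y c = len y x c"
  by (simp add: len_def mult_ac add_ac)

text \<open>A square plus a multiple of \<open>1 + c\<close>, at least one of them positive. One
  radius may be 0, as happens in the degenerate limits.\<close>

lemma len_sq_pos:
  assumes "0 \<le> x" "0 \<le> y" "0 < x \<or> 0 < y" "-1 < c"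
  shows "0 < x\<^sup>2 + y\<^sup>2 + 2 * x * y * (c :: real)"
proof -
  have *: "x\<^sup>2 + y\<^sup>2 + 2 * x * y * c = (x - y)\<^sup>2 + 2 * (x * y) * (1 + c)"
    by (simp add: power2_eq_square algebra_simps)
  show ?thesis
  proof (cases "x = y")
    case True
    then have "0 < x * y" using assms by auto
    then have "0 < 2 * (x * y) * (1 + c)" using assms(4) by (simp only: mult_pos_pos zero_less_numeral)
    then show ?thesis unfolding * by (intro add_nonneg_pos) simp_all
  next
    case False
    then show ?thesis unfolding * using assms by (intro add_pos_nonneg mult_nonneg_nonneg) simp_all
  qed
qed

lemma len_pos: "0 \<le> x \<Longrightarrow> 0 \<le> y \<Longrightarrow> 0 < x \<or> 0 < y \<Longrightarrow> -1 < c \<Longrightarrow> 0 < len x y c"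
  by (simp add: len_def len_sq_pos)

lemma len_sq: "0 < x \<Longrightarrow> 0 < y \<Longrightarrow> -1 < c \<Longrightarrow> (len x y c)\<^sup>2 = x\<^sup>2 + y\<^sup>2 + 2 * x * y * c"
  using len_sq_pos[of x y c] by (simp add: len_def)

text \<open>\<open>area\<close> is four times the square of the Euclidean area, so its positivity makes the triangle
  nondegenerate.\<close>

lemma area_pos:
  assumes "admissible a b c" "0 < x" "0 < y" "0 < z"
  shows "0 < area x y z a b c"
proof -
  have sq: "0 \<le> 1 - d\<^sup>2" if "-1 < d" "d \<le> 1" for d :: real
    using abs_square_le_1[of d] that by (simp add: abs_le_iff)
  have s: "0 \<le> x\<^sup>2 * y\<^sup>2 * (1 - c\<^sup>2)" "0 \<le> x\<^sup>2 * z\<^sup>2 * (1 - b\<^sup>2)" "0 \<le> y\<^sup>2 * z\<^sup>2 * (1 - a\<^sup>2)"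
    using assms sq by (auto simp: admissible_def intro!: mult_nonneg_nonneg)
  have t: "0 \<le> 2 * x * y * z * (x * (a + b * c) + y * (b + c * a) + z * (c + a * b))"
    using assms by (auto simp: admissible_def intro!: mult_nonneg_nonneg add_nonneg_nonneg)
  show ?thesis
  \<comment> \<open>If all cosines are 1, only the mixed term survives and it is positive; otherwise
    one of the first three terms is positive.\<close>
  proof (cases "a = 1 \<and> b = 1 \<and> c = 1")
    case True
    then show ?thesis using assms by (simp add: area_def)
  next
    case False
    have "0 < 1 - d\<^sup>2" if "-1 < d" "d \<le> 1" "d \<noteq> 1" for d :: real
      using abs_square_less_1[of d] that by (simp add: abs_less_iff)
    then have "0 < x\<^sup>2 * y\<^sup>2 * (1 - c\<^sup>2) \<or> 0 < x\<^sup>2 * z\<^sup>2 * (1 - b\<^sup>2) \<or> 0 < y\<^sup>2 * z\<^sup>2 * (1 - a\<^sup>2)"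
      using False assms by (auto simp: admissible_def)
    then show ?thesis unfolding area_def using s t by linarith
  qed
qed

text \<open>Squared lengths of two vectors multiply to the squared inner product plus the squared
  cross product. The latter is the same at all three vertices, which ties the three sines together
  in the angle sum.\<close>

lemma area_eq:
  "(x\<^sup>2 + y\<^sup>2 + 2 * x * y * c) * (x\<^sup>2 + z\<^sup>2 + 2 * x * z * b) =
    (x\<^sup>2 + x * y * c + x * z * b - y * z * a)\<^sup>2 + area x y z a b c"
  unfolding area_def by algebra

section \<open>The angle at one vertex: bounds, monotonicity in the other radii, limits\<close>

context
  fixes a b c :: real
  assumes adm: "admissible a b c"
begin

lemma cos_sq_area:
  assumes "0 < x" "0 < y" "0 < z"
  shows "1 - (cosang x y z a b c)\<^sup>2 = area x y z a b c / (len x y c * len x z b)\<^sup>2"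
proof -
  define L where "L = (len x y c * len x z b)\<^sup>2"
  have L: "L = (x\<^sup>2 + y\<^sup>2 + 2 * x * y * c) * (x\<^sup>2 + z\<^sup>2 + 2 * x * z * b)"
    using adm assms by (simp add: admissible_def L_def power_mult_distrib len_sq)
  have "len x y c > 0" "len x z b > 0" using adm assms by (auto simp: admissible_def intro!: len_pos)
  then have "L > 0" by (simp add: L_def)
  have "(cosang x y z a b c)\<^sup>2 = (x\<^sup>2 + x * y * c + x * z * b - y * z * a)\<^sup>2 / L"
    by (simp add: cosang_def L_def power_divide)
  also have "\<dots> = (L - area x y z a b c) / L"
    using L area_eq[of x y c z b a] by simp
  finally show ?thesis using \<open>L > 0\<close> by (simp add: L_def[symmetric] diff_divide_distrib)
qed

lemma cosang_less:
  assumes "0 < x" "0 < y" "0 < z"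
  shows "-1 < cosang x y z a b c" "cosang x y z a b c < 1"
proof -
  have "len x y c > 0" "len x z b > 0" using adm assms by (auto simp: admissible_def intro!: len_pos)
  then have "0 < 1 - (cosang x y z a b c)\<^sup>2"
    unfolding cos_sq_area[OF assms] using area_pos[OF adm assms] by (intro divide_pos_pos) auto
  then have "\<bar>cosang x y z a b c\<bar> < 1" by (simp add: abs_square_less_1[symmetric])
  then show "-1 < cosang x y z a b c" "cosang x y z a b c < 1" by (auto simp: abs_less_iff)
qed

lemma ang_bounds:
  assumes "0 < x" "0 < y" "0 < z"
  shows "0 < ang x y z a b c" "ang x y z a b c < pi"
  using arccos_lt_bounded[of "cosang x y z a b c"] cosang_less[OF assms] by (auto simp: ang_def)

lemma cos_ang:
  assumes "0 < x" "0 < y" "0 < z"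
  shows "cos (ang x y z a b c) = cosang x y z a b c"
  using cosang_less[OF assms] by (simp add: ang_def)

lemma sin_ang:
  assumes "0 < x" "0 < y" "0 < z"
  shows "sin (ang x y z a b c) = sqrt (area x y z a b c) / (len x y c * len x z b)"
proof -
  have "len x y c > 0" "len x z b > 0" using adm assms by (auto simp: admissible_def intro!: len_pos)
  moreover have "sin (ang x y z a b c) = sqrt (1 - (cosang x y z a b c)\<^sup>2)"
    unfolding ang_def using cosang_less[OF assms] by (intro sin_arccos) auto
  ultimately show ?thesis by (simp add: cos_sq_area[OF assms] real_sqrt_divide)
qed

lemma ang_scale:
  assumes "0 < k" "0 < x" "0 < y" "0 < z"
  shows "ang (k * x) (k * y) (k * z) a b c = ang x y z a b c"
proof -
  have len: "len (k * u) (k * v) d = k * len u v d" for u v d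
  proof -
    have "(k * u)\<^sup>2 + (k * v)\<^sup>2 + 2 * (k * u) * (k * v) * d = k\<^sup>2 * (u\<^sup>2 + v\<^sup>2 + 2 * u * v * d)"
      by algebra
    then show ?thesis using assms(1) by (simp add: len_def real_sqrt_mult)
  qed
  have "(k * x)\<^sup>2 + (k * x) * (k * y) * c + (k * x) * (k * z) * b - (k * y) * (k * z) * a
      = k\<^sup>2 * (x\<^sup>2 + x * y * c + x * z * b - y * z * a)" by algebra
  then show ?thesis using assms(1) by (simp add: ang_def cosang_def len power2_eq_square)
qed

text \<open>This is where (C1) yields monotonicity: after cancellation the numerator contains only
  \<open>1 - c\<^sup>2\<close> and two of the combinations that (C1) makes nonnegative.\<close>

lemma cosang_deriv:
  assumes "0 < x" "0 < y" "0 < z"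
  shows "((\<lambda>y. cosang x y z a b c) has_real_derivative
     - x * (x * y * (1 - c\<^sup>2) + x * z * (a + b * c) + y * z * (b + c * a)) / ((len x y c)^3 * len x z b)) (at y)"
proof -
  define q where "q = len x z b"
  define P where "P y = x\<^sup>2 + y\<^sup>2 + 2 * x * y * c" for y
  define N where "N y = x\<^sup>2 + x * y * c + x * z * b - y * z * a" for y
  have q: "q > 0" using adm assms by (auto simp: admissible_def q_def intro!: len_pos)
  have P: "P y > 0" unfolding P_def using adm assms by (intro len_sq_pos) (auto simp: admissible_def)
  define p where "p = sqrt (P y)"
  have p: "p > 0" "p\<^sup>2 = P y" using P by (auto simp: p_def)
  have "((\<lambda>y. N y / (sqrt (P y) * q)) has_real_derivative
      ((x * c - z * a) * (p * q) - N y * ((2 * y + 2 * x * c) * (inverse p / 2) * q)) / (p * q * (p * q))) (at y)"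
    unfolding P_def N_def p_def using q P
    by (auto intro!: derivative_eq_intros simp: P_def)
  also have "((x * c - z * a) * (p * q) - N y * ((2 * y + 2 * x * c) * (inverse p / 2) * q)) / (p * q * (p * q))
      = ((x * c - z * a) * p\<^sup>2 - N y * (y + x * c)) / (p ^ 3 * q)"
    using p(1) q by (simp add: field_simps power2_eq_square power3_eq_cube)
  also have "(x * c - z * a) * p\<^sup>2 - N y * (y + x * c)
      = - x * (x * y * (1 - c\<^sup>2) + x * z * (a + b * c) + y * z * (b + c * a))"
    unfolding p(2) P_def N_def by algebra
  finally show ?thesis
    by (simp add: cosang_def len_def P_def N_def p_def q_def)
qed

lemma ang_mono:
  assumes "0 < x" "0 < y" "0 < z" "y \<le> y'"
  shows "ang x y z a b c \<le> ang x y' z a b c"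
proof -
  have c2: "0 \<le> 1 - c\<^sup>2" using adm abs_square_le_1[of c] by (simp add: abs_le_iff admissible_def)
  have "cosang x y' z a b c \<le> cosang x y z a b c"
  proof (rule DERIV_nonpos_imp_nonincreasing[OF assms(4)])
    fix u assume "y \<le> u" "u \<le> y'"
    then have u: "0 < u" using assms by simp
    have nonneg: "0 \<le> x * u * (1 - c\<^sup>2)" "0 \<le> x * z * (a + b * c)" "0 \<le> u * z * (b + c * a)"
      using adm assms u c2 by (simp_all add: admissible_def)
    have "len x u c > 0" "len x z b > 0" using adm assms u by (auto simp: admissible_def intro!: len_pos)
    then have "- x * (x * u * (1 - c\<^sup>2) + x * z * (a + b * c) + u * z * (b + c * a)) / ((len x u c)^3 * len x z b) \<le> 0"
      using nonneg assms(1)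
      by (intro divide_nonpos_nonneg mult_nonpos_nonneg add_nonneg_nonneg) simp_all
    then show "\<exists>l. ((\<lambda>y. cosang x y z a b c) has_real_derivative l) (at u) \<and> l \<le> 0"
      using cosang_deriv[OF assms(1) u assms(3)] by blast
  qed
  then show ?thesis unfolding ang_def
    using cosang_less[of x y z] cosang_less[of x y' z] assms by (intro arccos_le_arccos) auto
qed

text \<open>The derivative can vanish only if \<open>c\<^sup>2 = 1\<close> and
  \<open>a + b * c = 0\<close>; as \<open>c > -1\<close>, that is the excluded case.\<close>

lemma ang_strict_mono:
  assumes "0 < x" "0 < y" "0 < z" "y < y'" "\<not> (c = 1 \<and> a + b = 0)"
  shows "ang x y z a b c < ang x y' z a b c"
proof -
  have c2: "0 \<le> 1 - c\<^sup>2" using adm abs_square_le_1[of c] by (simp add: abs_le_iff admissible_def)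
  have "cosang x y' z a b c < cosang x y z a b c"
  proof (rule DERIV_neg_imp_decreasing[OF assms(4)])
    fix u assume "y \<le> u" "u \<le> y'"
    then have u: "0 < u" using assms by simp
    have L: "len x u c > 0" "len x z b > 0" using adm assms u by (auto simp: admissible_def intro!: len_pos)
    have nonneg: "0 \<le> x * u * (1 - c\<^sup>2)" "0 \<le> x * z * (a + b * c)" "0 \<le> u * z * (b + c * a)"
      using adm assms u c2 by (simp_all add: admissible_def)
    have "0 < x * u * (1 - c\<^sup>2) \<or> 0 < x * z * (a + b * c)"
    proof (cases "c = 1")
      case True
      then have "a + b * c > 0" using adm assms(5) by (auto simp: admissible_def)
      then show ?thesis using assms by simp
    next
      case False
      then have "0 < 1 - c\<^sup>2" using abs_square_less_1[of c] adm by (simp add: abs_less_iff admissible_def)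
      then show ?thesis using assms u by simp
    qed
    then have "0 < x * u * (1 - c\<^sup>2) + x * z * (a + b * c) + u * z * (b + c * a)"
      using nonneg by linarith
    then have "- x * (x * u * (1 - c\<^sup>2) + x * z * (a + b * c) + u * z * (b + c * a)) / ((len x u c)^3 * len x z b) < 0"
      using L assms(1) by (intro divide_neg_pos mult_neg_pos mult_pos_pos) auto
    then show "\<exists>l. ((\<lambda>y. cosang x y z a b c) has_real_derivative l) (at u) \<and> l < 0"
      using cosang_deriv[OF assms(1) u assms(3)] by blast
  qed
  then show ?thesis unfolding ang_def
    using cosang_less[of x y z] cosang_less[of x y' z] assms by (intro arccos_less_arccos) auto
qed

text \<open>The condition on the limit says that both sides at the vertex keep positive length,
  while the opposite side may collapse. The limiting cosine may be 1 or -1, so continuity of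
  \<open>arccos\<close> on the closed interval is needed.\<close>

lemma ang_tendsto:
  assumes "\<And>n. 0 < X n" "\<And>n. 0 < Y n" "\<And>n. 0 < Z n"
    and "X \<longlonglongrightarrow> x" "Y \<longlonglongrightarrow> y" "Z \<longlonglongrightarrow> z" "0 < x \<or> 0 < y \<and> 0 < z"
  shows "(\<lambda>n. ang (X n) (Y n) (Z n) a b c) \<longlonglongrightarrow> ang x y z a b c"
proof -
  have nonneg: "0 \<le> x" "0 \<le> y" "0 \<le> z"
    by (rule LIMSEQ_le_const[OF assms(4)], use assms(1) less_imp_le in blast,
      rule LIMSEQ_le_const[OF assms(5)], use assms(2) less_imp_le in blast,
      rule LIMSEQ_le_const[OF assms(6)], use assms(3) less_imp_le in blast)
  have "len x y c \<noteq> 0" "len x z b \<noteq> 0"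
    using len_pos[of x y c] len_pos[of x z b] adm assms(7) nonneg by (auto simp: admissible_def)
  then have lim: "(\<lambda>n. cosang (X n) (Y n) (Z n) a b c) \<longlonglongrightarrow> cosang x y z a b c"
    unfolding cosang_def len_def by (intro tendsto_intros assms) auto
  have bd: "-1 \<le> cosang (X n) (Y n) (Z n) a b c" "cosang (X n) (Y n) (Z n) a b c \<le> 1" for n
    using cosang_less[of "X n" "Y n" "Z n"] assms(1-3) by (auto intro: less_imp_le)
  have "-1 \<le> cosang x y z a b c" "cosang x y z a b c \<le> 1"
    using LIMSEQ_le_const[OF lim] LIMSEQ_le_const2[OF lim] bd by auto
  then show ?thesis unfolding ang_def
    using bd by (intro continuous_on_tendsto_compose[OF continuous_on_arccos' lim]) auto
qed

end

text \<open>The angles are given by formulas, so their sum has to be computed: \<open>cos\<close> of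
  the first two together is minus \<open>cos\<close> of the third, and a positive \<open>sin\<close>
  selects the right solution.\<close>

lemma ang_sum:
  assumes adm: "admissible a b c" and xyz: "0 < x" "0 < y" "0 < z"
  shows "ang x y z a b c + ang y z x b c a + ang z x y c a b = pi"
proof -
  note adm' = admissible_rotate[OF adm] admissible_rotate[OF admissible_rotate[OF adm]]
  let ?\<alpha> = "ang x y z a b c" and ?\<beta> = "ang y z x b c a" and ?\<gamma> = "ang z x y c a b"
  define p q r where "p = len x y c" and "q = len y z a" and "r = len z x b"
  have pos: "p > 0" "q > 0" "r > 0"
    using adm xyz by (auto simp: admissible_def p_def q_def r_def intro!: len_pos)
  have p2: "p\<^sup>2 = x\<^sup>2 + y\<^sup>2 + 2 * x * y * c"
    using adm xyz by (simp add: admissible_def p_def len_sq)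
  define D where "D = sqrt (area x y z a b c)"
  have D2: "D\<^sup>2 = area x y z a b c" and D: "D > 0"
    using area_pos[OF adm xyz] by (auto simp: D_def)
  define n1 n2 n3 where "n1 = x\<^sup>2 + x * y * c + x * z * b - y * z * a"
    and "n2 = y\<^sup>2 + y * z * a + y * x * c - z * x * b"
    and "n3 = z\<^sup>2 + z * x * b + z * y * a - x * y * c"
  have c1: "cos ?\<alpha> = n1 / (p * r)"
    using cos_ang[OF adm xyz] by (simp add: cosang_def n1_def p_def r_def len_commute)
  have c2: "cos ?\<beta> = n2 / (q * p)"
    using xyz by (subst cos_ang[OF adm'(1)]) (simp_all add: cosang_def n2_def p_def q_def len_commute)
  have c3: "cos ?\<gamma> = n3 / (r * q)"
    using xyz by (subst cos_ang[OF adm'(2)]) (simp_all add: cosang_def n3_def r_def q_def len_commute)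
  have s1: "sin ?\<alpha> = D / (p * r)"
    using sin_ang[OF adm xyz] by (simp add: D_def p_def r_def len_commute)
  have s2: "sin ?\<beta> = D / (q * p)"
    using xyz by (subst sin_ang[OF adm'(1)]) (simp_all add: D_def p_def q_def len_commute area_rotate[of x y z])
  \<comment> \<open>Divided by \<open>p\<close>, the numbers \<open>n1\<close> and \<open>n2\<close>
    are the signed projections of the other two sides onto the side of length
    \<open>p\<close>.\<close>
  have n12: "n1 + n2 = p\<^sup>2" unfolding n1_def n2_def p2 by algebra
  have n123: "n1 * n2 - D\<^sup>2 = - n3 * p\<^sup>2"
    unfolding n1_def n2_def n3_def p2 D2 area_def by algebra
  have "sin (?\<alpha> + ?\<beta>) = D * (n1 + n2) / (p\<^sup>2 * q * r)"
    using pos by (simp add: sin_add c1 c2 s1 s2 field_simps power2_eq_square)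
  then have "sin (?\<alpha> + ?\<beta>) > 0" using D pos by (simp add: n12)
  have "cos (?\<alpha> + ?\<beta>) = (n1 * n2 - D\<^sup>2) / (p\<^sup>2 * q * r)"
    using pos by (simp add: cos_add c1 c2 s1 s2 field_simps power2_eq_square)
  also have "\<dots> = - cos ?\<gamma>" using pos by (simp add: n123 c3 field_simps)
  also have "\<dots> = cos (pi - ?\<gamma>)" by simp
  finally have eq: "cos (?\<alpha> + ?\<beta>) = cos (pi - ?\<gamma>)" .
  have b: "0 < ?\<alpha>" "?\<alpha> < pi" "0 < ?\<beta>" "?\<beta> < pi" "0 < ?\<gamma>" "?\<gamma> < pi"
    using ang_bounds[OF adm xyz] ang_bounds[OF adm'(1), of y z x] ang_bounds[OF adm'(2), of z x y] xyz by auto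
  have "?\<alpha> + ?\<beta> \<le> pi"
  proof (rule ccontr)
    assume "\<not> ?thesis"
    then have "sin (?\<alpha> + ?\<beta> - pi) \<ge> 0" using b by (intro sin_ge_zero) auto
    then show False using \<open>sin (?\<alpha> + ?\<beta>) > 0\<close> by simp
  qed
  then have "?\<alpha> + ?\<beta> = pi - ?\<gamma>" using b by (intro cos_inj_pi[OF _ _ _ _ eq]) linarith+
  then show ?thesis by simp
qed

text \<open>For \<open>a = cos \<Theta>\<close> with a label in [0, pi) this is pi minus the label,
  the source of the link terms in the bound.\<close>

lemma ang_zero_left: "0 < y \<Longrightarrow> 0 < z \<Longrightarrow> ang 0 y z a b c = arccos (- a)"
  by (simp add: ang_def cosang_def len_def)

lemma ang_zero_right: "0 < x \<Longrightarrow> ang x 0 0 a b c = 0"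
  by (simp add: ang_def cosang_def len_def power2_eq_square)

section \<open>The triangulated surface\<close>

text \<open>A weak edge is the only way for the angle at \<open>v\<close> not to react to the radius at \<open>w\<close>. As
  \<open>cos \<Theta> > -1\<close>, a triangle has at most one, so the strong edges still connect the surface.\<close>

definition weak_edge :: "('v set \<Rightarrow> real) \<Rightarrow> 'v \<Rightarrow> 'v \<Rightarrow> 'v \<Rightarrow> bool" where
  "weak_edge \<Theta> v w u \<longleftrightarrow> cos (\<Theta> {v, w}) = 1 \<and> cos (\<Theta> {w, u}) + cos (\<Theta> {v, u}) = 0"

definition strong :: "'v set set \<Rightarrow> ('v set \<Rightarrow> real) \<Rightarrow> 'v \<Rightarrow> 'v \<Rightarrow> bool" where
  "strong F \<Theta> v w \<longleftrightarrow> (\<exists>u. {v, w, u} \<in> F \<and> v \<noteq> w \<and> v \<noteq> u \<and> w \<noteq> u \<and> \<not> weak_edge \<Theta> v w u)"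

text \<open>The limit of the sum of the angles of \<open>t\<close> at its vertices in \<open>A\<close> as the radii on \<open>A\<close>
  shrink to \<open>0\<close>.\<close>

definition tri_sup :: "('v set \<Rightarrow> real) \<Rightarrow> 'v set \<Rightarrow> 'v set \<Rightarrow> real" where
  "tri_sup \<Theta> A t = (if card (t \<inter> A) \<ge> 2 then pi else if t \<inter> A = {} then 0 else pi - \<Theta> (t - A))"

definition angle_sup :: "'v set set \<Rightarrow> ('v set \<Rightarrow> real) \<Rightarrow> 'v set \<Rightarrow> real" where
  "angle_sup F \<Theta> A = (\<Sum>t\<in>F. tri_sup \<Theta> A t)"

locale weighted_triangulation =
  fixes V :: "'v set" and F :: "'v set set" and \<Theta> :: "'v set \<Rightarrow> real"
  assumes tri: "surface_triangulation V F"
    and Theta_range: "\<forall>e\<in>edges F. 0 \<le> \<Theta> e \<and> \<Theta> e < pi"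
    and C1: "cond_C1 F \<Theta>"
begin

section \<open>Angles of the triangles of the surface\<close>

lemma V_finite: "finite V" and F_nonempty: "F \<noteq> {}" and V_Union: "V = \<Union>F"
  and tri_subset: "t \<in> F \<Longrightarrow> t \<subseteq> V" and tri_card: "t \<in> F \<Longrightarrow> card t = 3"
  using tri by (auto simp: surface_triangulation_def)

lemma F_finite: "finite F"
  using V_finite tri_subset by (intro finite_subset[of F "Pow V"]) auto

lemma tri_finite: "t \<in> F \<Longrightarrow> finite t"
  using tri_card by (metis card.infinite zero_neq_numeral)

lemma tri_obtain:
  assumes "t \<in> F" "v \<in> t"
  obtains a b where "t = {v, a, b}" "v \<noteq> a" "v \<noteq> b" "a \<noteq> b"
proof -
  have "card (t - {v}) = 2" using tri_card[OF assms(1)] assms(2) by simp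
  then obtain a b where "t - {v} = {a, b}" "a \<noteq> b" by (auto simp: card_2_iff)
  then show ?thesis using that[of a b] assms(2) by auto
qed

lemma tri_edge: "t \<in> F \<Longrightarrow> a \<in> t \<Longrightarrow> b \<in> t \<Longrightarrow> a \<noteq> b \<Longrightarrow> {a, b} \<in> edges F"
  by (auto simp: edges_def)

lemma cos_Theta:
  assumes "e \<in> edges F"
  shows "-1 < cos (\<Theta> e)" "cos (\<Theta> e) \<le> 1"
  using cos_monotone_0_pi[of "\<Theta> e" pi] Theta_range assms by auto

lemma admissible_tri:
  assumes "{v, a, b} \<in> F" "v \<noteq> a" "v \<noteq> b" "a \<noteq> b"
  shows "admissible (cos (\<Theta> {a, b})) (cos (\<Theta> {v, b})) (cos (\<Theta> {v, a}))"
proof -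
  have C: "cos (\<Theta> {x, y}) + cos (\<Theta> {y, z}) * cos (\<Theta> {z, x}) \<ge> 0" if "{v, a, b} = {x, y, z}" for x y z
    using C1 assms(1) that unfolding cond_C1_def by blast
  have "{a, b} \<in> edges F" "{v, b} \<in> edges F" "{v, a} \<in> edges F"
    using assms by (auto intro: tri_edge[OF assms(1)])
  then show ?thesis
    using C[of a b v] C[of v b a] C[of v a b] cos_Theta
    by (auto simp: admissible_def insert_commute mult.commute)
qed

lemma eangle_eq:
  assumes "{v, a, b} \<in> F" "v \<noteq> a" "v \<noteq> b" "a \<noteq> b" "\<forall>w\<in>V. r w > 0"
  shows "eangle \<Theta> r v a b =
    ang (r v) (r a) (r b) (cos (\<Theta> {a, b})) (cos (\<Theta> {v, b})) (cos (\<Theta> {v, a}))"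
proof -
  have pos: "0 < r v" "0 < r a" "0 < r b" using tri_subset[OF assms(1)] assms(5) by auto
  note adm = admissible_tri[OF assms(1-4)]
  have len: "elen \<Theta> r x y = len (r x) (r y) (cos (\<Theta> {x, y}))" for x y
    by (simp add: elen_def len_def)
  have "(elen \<Theta> r v a)\<^sup>2 + (elen \<Theta> r v b)\<^sup>2 - (elen \<Theta> r a b)\<^sup>2 =
      2 * ((r v)\<^sup>2 + r v * r a * cos (\<Theta> {v, a}) + r v * r b * cos (\<Theta> {v, b}) - r a * r b * cos (\<Theta> {a, b}))"
    using pos adm by (simp add: len len_sq admissible_def algebra_simps)
  then have "eangle \<Theta> r v a b = arccos (2 * ((r v)\<^sup>2 + r v * r a * cos (\<Theta> {v, a}) +
      r v * r b * cos (\<Theta> {v, b}) - r a * r b * cos (\<Theta> {a, b})) / (2 * (elen \<Theta> r v a * elen \<Theta> r v b)))"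
    by (simp only: eangle_def mult.assoc)
  then show ?thesis by (simp only: mult_divide_mult_cancel_left_if) (simp add: ang_def cosang_def len)
qed

text \<open>\<open>tri_angle\<close> orders the other two vertices by an arbitrary choice. There are
  only two orders, and the symmetry of \<open>ang\<close> makes them agree.\<close>

lemma tri_angle_eq:
  assumes "{v, a, b} \<in> F" "v \<noteq> a" "v \<noteq> b" "a \<noteq> b" "\<forall>w\<in>V. r w > 0"
  shows "tri_angle \<Theta> r {v, a, b} v =
    ang (r v) (r a) (r b) (cos (\<Theta> {a, b})) (cos (\<Theta> {v, b})) (cos (\<Theta> {v, a}))"
proof -
  define p where "p = (SOME p. fst p \<noteq> snd p \<and> {v, a, b} = {v, fst p, snd p})"
  have "fst p \<noteq> snd p \<and> {v, a, b} = {v, fst p, snd p}"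
    unfolding p_def by (rule someI[of _ "(a, b)"]) (use assms in auto)
  then have "fst p = a \<and> snd p = b \<or> fst p = b \<and> snd p = a"
    using assms(2-4) by (auto simp: set_eq_iff) metis+
  moreover have "tri_angle \<Theta> r {v, a, b} v = eangle \<Theta> r v (fst p) (snd p)"
    by (simp add: tri_angle_def p_def Let_def)
  moreover have "eangle \<Theta> r v b a = eangle \<Theta> r v a b"
    using assms by (subst (1 2) eangle_eq) (auto simp: insert_commute intro: ang_swap)
  ultimately show ?thesis using eangle_eq[OF assms] by auto
qed

lemma tri_angle_pos:
  assumes "t \<in> F" "v \<in> t" "\<forall>w\<in>V. r w > 0"
  shows "0 < tri_angle \<Theta> r t v"
proof -
  obtain a b where t: "t = {v, a, b}" "v \<noteq> a" "v \<noteq> b" "a \<noteq> b"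
    using tri_obtain[OF assms(1,2)] .
  show ?thesis using assms t tri_subset[OF assms(1)]
    by (simp add: tri_angle_eq ang_bounds admissible_tri)
qed

lemma tri_angle_sum:
  assumes "t \<in> F" "\<forall>w\<in>V. r w > 0"
  shows "(\<Sum>v\<in>t. tri_angle \<Theta> r t v) = pi"
proof -
  obtain v where "v \<in> t" using tri_card[OF assms(1)] by fastforce
  then obtain a b where t: "t = {v, a, b}" "v \<noteq> a" "v \<noteq> b" "a \<noteq> b"
    using tri_obtain[OF assms(1)] by metis
  have F: "{v, a, b} \<in> F" "{a, b, v} \<in> F" "{b, v, a} \<in> F"
    using assms(1) t by (auto simp: insert_commute)
  have "tri_angle \<Theta> r t a = tri_angle \<Theta> r {a, b, v} a" "tri_angle \<Theta> r t b = tri_angle \<Theta> r {b, v, a} b"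
    by (simp_all add: t insert_commute)
  then show ?thesis
    using ang_sum[OF admissible_tri[OF F(1)], of "r v" "r a" "r b"] t assms(2) F tri_subset[OF F(1)]
    by (simp add: tri_angle_eq) (simp add: insert_commute)
qed

lemma tri_angle_mono:
  assumes "t \<in> F" "v \<in> t" and pos: "\<forall>w\<in>V. r w > 0" and le: "\<forall>w\<in>V. r w \<le> r' w" and eq: "r v = r' v"
  shows "tri_angle \<Theta> r t v \<le> tri_angle \<Theta> r' t v"
proof -
  obtain a b where t: "t = {v, a, b}" "v \<noteq> a" "v \<noteq> b" "a \<noteq> b"
    using tri_obtain[OF assms(1,2)] .
  have V: "v \<in> V" "a \<in> V" "b \<in> V" using t tri_subset[OF assms(1)] by auto
  have pos': "\<forall>w\<in>V. r' w > 0" using pos le by (meson less_le_trans)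
  let ?a = "cos (\<Theta> {a, b})" and ?b = "cos (\<Theta> {v, b})" and ?c = "cos (\<Theta> {v, a})"
  note adm = admissible_tri[OF assms(1)[unfolded t(1)] t(2-4)]
  \<comment> \<open>The two radii are raised one at a time, the second after exchanging the roles of
    \<open>a\<close> and \<open>b\<close>.\<close>
  have "ang (r v) (r a) (r b) ?a ?b ?c \<le> ang (r v) (r' a) (r b) ?a ?b ?c"
    using V pos le by (intro ang_mono[OF adm]) auto
  also have "\<dots> \<le> ang (r v) (r' a) (r' b) ?a ?b ?c"
    unfolding ang_swap[of _ "r' a"] using V pos pos' le
    by (intro ang_mono[OF admissible_swap[OF adm]]) auto
  finally show ?thesis using t assms(1) pos pos' eq by (simp add: tri_angle_eq)
qed

lemma tri_angle_strict:
  assumes F: "{v, a, b} \<in> F" and dist: "v \<noteq> a" "v \<noteq> b" "a \<noteq> b" and strong: "\<not> weak_edge \<Theta> v a b"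
    and pos: "\<forall>w\<in>V. r w > 0" and le: "\<forall>w\<in>V. r w \<le> r' w" and eq: "r v = r' v" and less: "r a < r' a"
  shows "tri_angle \<Theta> r {v, a, b} v < tri_angle \<Theta> r' {v, a, b} v"
proof -
  have V: "v \<in> V" "a \<in> V" "b \<in> V" using tri_subset[OF F] by auto
  have pos': "\<forall>w\<in>V. r' w > 0" using pos le by (meson less_le_trans)
  let ?a = "cos (\<Theta> {a, b})" and ?b = "cos (\<Theta> {v, b})" and ?c = "cos (\<Theta> {v, a})"
  note adm = admissible_tri[OF F dist]
  have "ang (r v) (r a) (r b) ?a ?b ?c < ang (r v) (r' a) (r b) ?a ?b ?c"
    using V pos less strong by (intro ang_strict_mono[OF adm]) (auto simp: weak_edge_def)
  also have "\<dots> \<le> ang (r v) (r' a) (r' b) ?a ?b ?c"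
    unfolding ang_swap[of _ "r' a"] using V pos pos' le
    by (intro ang_mono[OF admissible_swap[OF adm]]) auto
  finally show ?thesis using F dist pos pos' eq by (simp add: tri_angle_eq)
qed

lemma tri_angle_scale:
  assumes "t \<in> F" "v \<in> t" "\<forall>w\<in>V. r w > 0" "c > 0"
  shows "tri_angle \<Theta> (\<lambda>w. c * r w) t v = tri_angle \<Theta> r t v"
proof -
  obtain a b where t: "t = {v, a, b}" "v \<noteq> a" "v \<noteq> b" "a \<noteq> b"
    using tri_obtain[OF assms(1,2)] .
  show ?thesis using assms t tri_subset[OF assms(1)]
    by (simp add: tri_angle_eq ang_scale admissible_tri)
qed

lemma tri_angle_tendsto:
  assumes F: "{v, a, b} \<in> F" and dist: "v \<noteq> a" "v \<noteq> b" "a \<noteq> b"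
    and pos: "\<And>n. \<forall>w\<in>V. \<rho> n w > 0" and lim: "\<forall>w\<in>V. (\<lambda>n. \<rho> n w) \<longlonglongrightarrow> r w"
    and r: "0 < r v \<or> 0 < r a \<and> 0 < r b"
  shows "(\<lambda>n. tri_angle \<Theta> (\<rho> n) {v, a, b} v) \<longlonglongrightarrow>
    ang (r v) (r a) (r b) (cos (\<Theta> {a, b})) (cos (\<Theta> {v, b})) (cos (\<Theta> {v, a}))"
proof -
  have "v \<in> V" "a \<in> V" "b \<in> V" using tri_subset[OF F] by auto
  then show ?thesis using assms
    by (simp add: tri_angle_eq) (intro ang_tendsto admissible_tri, auto)
qed

lemma tri_angle_cont:
  assumes "t \<in> F" "v \<in> t" "\<And>n. \<forall>w\<in>V. \<rho> n w > 0" "\<forall>w\<in>V. (\<lambda>n. \<rho> n w) \<longlonglongrightarrow> r w" "\<forall>w\<in>V. r w > 0"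
  shows "(\<lambda>n. tri_angle \<Theta> (\<rho> n) t v) \<longlonglongrightarrow> tri_angle \<Theta> r t v"
proof -
  obtain a b where t: "t = {v, a, b}" "v \<noteq> a" "v \<noteq> b" "a \<noteq> b"
    using tri_obtain[OF assms(1,2)] .
  have "v \<in> V" using assms(1,2) tri_subset by auto
  then show ?thesis
    using tri_angle_tendsto[of v a b \<rho> r] assms t by (simp add: tri_angle_eq)
qed

lemma tri_angle_degenerate:
  assumes "t \<in> F" and pos: "\<And>n. \<forall>w\<in>V. \<rho> n w > 0" and lim: "\<forall>w\<in>V. (\<lambda>n. \<rho> n w) \<longlonglongrightarrow> r w"
    and A: "A \<subseteq> V" "\<forall>w\<in>A. r w = 0" "\<forall>w\<in>V - A. r w > 0"
  shows "(\<lambda>n. \<Sum>v\<in>t \<inter> A. tri_angle \<Theta> (\<rho> n) t v) \<longlonglongrightarrow> tri_sup \<Theta> A t"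
proof -
  note fin = tri_finite[OF assms(1)]
  have split: "card (t \<inter> A) + card (t - A) = 3"
    using card_Int_Diff[OF fin, of A] tri_card[OF assms(1)] by simp
  then consider "card (t \<inter> A) = 0" | "card (t \<inter> A) = 1" | "card (t - A) = 1" "card (t \<inter> A) = 2"
    | "card (t - A) = 0" "card (t \<inter> A) = 3"
    by linarith
  then show ?thesis
  proof cases
    case 1
    then have "t \<inter> A = {}" using fin by simp
    then show ?thesis by (simp add: tri_sup_def)
  next
    case 2
    then obtain v where v: "t \<inter> A = {v}" by (auto simp: card_1_singleton_iff)
    then obtain a b where t: "t = {v, a, b}" "v \<noteq> a" "v \<noteq> b" "a \<noteq> b"
      using tri_obtain[OF assms(1), of v] by blast
    have mem: "v \<in> A" "a \<notin> A" "b \<notin> A" using v t by auto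
    then have r: "r v = 0" "0 < r a" "0 < r b" using A tri_subset[OF assms(1)] t by auto
    have "0 \<le> \<Theta> {a, b}" "\<Theta> {a, b} < pi" using Theta_range tri_edge[OF assms(1), of a b] t by auto
    then have "arccos (- cos (\<Theta> {a, b})) = pi - \<Theta> {a, b}"
      using arccos_cos[of "pi - \<Theta> {a, b}"] by simp
    moreover have "t - A = {a, b}" using mem t by auto
    ultimately show ?thesis
      using tri_angle_tendsto[of v a b \<rho> r] assms(1) t pos lim r v
      by (simp add: tri_sup_def ang_zero_left)
  next
    case 3
    then obtain b where b: "t - A = {b}" by (auto simp: card_1_singleton_iff)
    then obtain v a where t: "t = {b, v, a}" "b \<noteq> v" "b \<noteq> a" "v \<noteq> a"
      using tri_obtain[OF assms(1), of b] by blast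
    have mem: "b \<notin> A" "v \<in> A" "a \<in> A" using b t by auto
    then have r: "0 < r b" "r v = 0" "r a = 0" using A tri_subset[OF assms(1)] t by auto
    have "t \<inter> A = t - {b}" using mem t by auto
    \<comment> \<open>The two angles at shrinking vertices need not converge separately, as they may
      depend on the ratio of the radii. Their sum is controlled through the third angle, which tends
      to 0.\<close>
    then have "(\<Sum>v\<in>t \<inter> A. tri_angle \<Theta> (\<rho> n) t v) = pi - tri_angle \<Theta> (\<rho> n) t b" for n
      using tri_angle_sum[OF assms(1) pos, of n] fin t by (simp add: sum_diff1)
    moreover have "(\<lambda>n. tri_angle \<Theta> (\<rho> n) t b) \<longlonglongrightarrow> 0"
      using tri_angle_tendsto[of b v a \<rho> r] assms(1) t pos lim r by (simp add: ang_zero_right)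
    then have "(\<lambda>n. pi - tri_angle \<Theta> (\<rho> n) t b) \<longlonglongrightarrow> pi - 0" by (intro tendsto_intros)
    ultimately show ?thesis using 3 by (simp add: tri_sup_def)
  next
    case 4
    then have "t \<inter> A = t" using fin by auto
    then show ?thesis using 4 tri_angle_sum[OF assms(1) pos] by (simp add: tri_sup_def)
  qed
qed

section \<open>Cone angles of the surface as an angle system\<close>

lemma cone_angle_sum:
  assumes "A \<subseteq> V"
  shows "(\<Sum>v\<in>A. cone_angle F \<Theta> r v) = (\<Sum>t\<in>F. \<Sum>v\<in>t \<inter> A. tri_angle \<Theta> r t v)"
proof -
  have "finite A" using assms V_finite finite_subset by blast
  then have "(\<Sum>v\<in>A. cone_angle F \<Theta> r v) = (\<Sum>t\<in>F. \<Sum>v\<in>{v \<in> A. v \<in> t}. tri_angle \<Theta> r t v)"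
    unfolding cone_angle_def using F_finite by (rule sum.swap_restrict)
  also have "\<dots> = (\<Sum>t\<in>F. \<Sum>v\<in>t \<inter> A. tri_angle \<Theta> r t v)"
    by (intro sum.cong) auto
  finally show ?thesis .
qed

lemma strong_connected:
  assumes "v \<in> V" "w \<in> V"
  shows "(strong F \<Theta>)\<^sup>*\<^sup>* v w"
proof -
  have "(strong F \<Theta>)\<^sup>*\<^sup>* x y" if xy: "{x, y} \<in> edges F" for x y
  proof -
    have "x \<noteq> y" using xy by (auto simp: edges_def)
    obtain t where t: "t \<in> F" "{x, y} \<subseteq> t" using xy by (auto simp: edges_def)
    then obtain a b where "t = {x, a, b}" "x \<noteq> a" "x \<noteq> b" "a \<noteq> b" using tri_obtain[of t x] by auto
    then obtain u where u: "t = {x, y, u}" "x \<noteq> u" "y \<noteq> u"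
      using t(2) \<open>x \<noteq> y\<close> by (cases "y = a") (auto simp: insert_commute)
    have e: "-1 < cos (\<Theta> {x, u})" "-1 < cos (\<Theta> {y, u})"
      using u tri_edge[OF t(1)] by (auto intro!: cos_Theta)
    have F: "{x, y, u} \<in> F" "{x, u, y} \<in> F" "{u, y, x} \<in> F" using t(1) u by (auto simp: insert_commute)
    show ?thesis
    proof (cases "weak_edge \<Theta> x y u")
      case True
      then have "\<not> weak_edge \<Theta> x u y" "\<not> weak_edge \<Theta> u y x"
        using e by (auto simp: weak_edge_def insert_commute)
      then have "strong F \<Theta> x u" "strong F \<Theta> u y"
        using F u \<open>x \<noteq> y\<close> unfolding strong_def by blast+
      then show ?thesis by (meson converse_rtranclp_into_rtranclp r_into_rtranclp)
    next
      case False
      then have "strong F \<Theta> x y" using F u \<open>x \<noteq> y\<close> unfolding strong_def by blast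
      then show ?thesis by auto
    qed
  qed
  moreover have "(\<lambda>x y. {x, y} \<in> edges F)\<^sup>*\<^sup>* v w"
    using tri assms by (auto simp: surface_triangulation_def)
  ultimately show ?thesis
    by (induction rule: rtranclp_induct[OF \<open>(\<lambda>x y. {x, y} \<in> edges F)\<^sup>*\<^sup>* v w\<close>]) (auto intro: rtranclp_trans)
qed

sublocale angle_system V "cone_angle F \<Theta>" "angle_sup F \<Theta>" "strong F \<Theta>"
proof
  show "finite V" by (rule V_finite)
  obtain t where "t \<in> F" using F_nonempty by auto
  then show "V \<noteq> {}" using tri_card[of t] tri_subset[of t] by auto
  show "v \<in> V \<and> w \<in> V" if "strong F \<Theta> v w" for v w
    using that tri_subset by (auto simp: strong_def)
  show "strong F \<Theta> w v" if vw: "strong F \<Theta> v w" for v w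
  proof -
    obtain u where u: "{v, w, u} \<in> F" "v \<noteq> w" "v \<noteq> u" "w \<noteq> u" "\<not> weak_edge \<Theta> v w u"
      using vw unfolding strong_def by blast
    then have "\<not> weak_edge \<Theta> w v u" by (auto simp: weak_edge_def insert_commute add.commute)
    then show ?thesis using u unfolding strong_def by (metis insert_commute)
  qed
  show "(strong F \<Theta>)\<^sup>*\<^sup>* v w" if "v \<in> V" "w \<in> V" for v w using that by (rule strong_connected)
  show "cone_angle F \<Theta> (\<lambda>w. c * r w) v = cone_angle F \<Theta> r v"
    if "c > 0" "\<forall>w\<in>V. r w > 0" "v \<in> V" for c r v
    unfolding cone_angle_def using that by (intro sum.cong) (auto simp: tri_angle_scale)
  show "cone_angle F \<Theta> r v \<le> cone_angle F \<Theta> r' v"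
    if "\<forall>w\<in>V. r w > 0" "\<forall>w\<in>V. r w \<le> r' w" "v \<in> V" "r v = r' v" for r r' v
    unfolding cone_angle_def using that by (intro sum_mono tri_angle_mono) auto
  show "cone_angle F \<Theta> r v < cone_angle F \<Theta> r' v"
    if "\<forall>w\<in>V. r w > 0" "\<forall>w\<in>V. r w \<le> r' w" "r v = r' v" and vw: "strong F \<Theta> v w" and "r w < r' w" for r r' v w
  proof -
    obtain u where u: "{v, w, u} \<in> F" "v \<noteq> w" "v \<noteq> u" "w \<noteq> u" "\<not> weak_edge \<Theta> v w u"
      using vw unfolding strong_def by blast
    show ?thesis unfolding cone_angle_def
    proof (rule sum_strict_mono_ex1)
      show "finite {t \<in> F. v \<in> t}" using F_finite by simp
      show "\<forall>t\<in>{t \<in> F. v \<in> t}. tri_angle \<Theta> r t v \<le> tri_angle \<Theta> r' t v"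
        using that by (auto intro: tri_angle_mono)
      show "\<exists>t\<in>{t \<in> F. v \<in> t}. tri_angle \<Theta> r t v < tri_angle \<Theta> r' t v"
        using tri_angle_strict[OF u that(1-3) that(5)] u by (intro bexI[of _ "{v, w, u}"]) auto
    qed
  qed
  show "(\<Sum>v\<in>V. cone_angle F \<Theta> r v) = angle_sup F \<Theta> V" if "\<forall>w\<in>V. r w > 0" for r
    unfolding cone_angle_sum[OF order.refl] angle_sup_def
  proof (intro sum.cong refl)
    fix t assume t: "t \<in> F"
    then have "t \<inter> V = t" using tri_subset by auto
    then show "(\<Sum>v\<in>t \<inter> V. tri_angle \<Theta> r t v) = tri_sup \<Theta> V t"
      using tri_angle_sum[OF t that] tri_card[OF t] by (simp add: tri_sup_def)
  qed
  show "(\<lambda>n. cone_angle F \<Theta> (\<rho> n) v) \<longlonglongrightarrow> cone_angle F \<Theta> r v"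
    if "\<And>n. \<forall>w\<in>V. \<rho> n w > 0" "\<forall>w\<in>V. (\<lambda>n. \<rho> n w) \<longlonglongrightarrow> r w" "\<forall>w\<in>V. r w > 0" "v \<in> V" for \<rho> r v
    unfolding cone_angle_def using that by (intro tendsto_sum tri_angle_cont) auto
  show "(\<lambda>n. \<Sum>v\<in>A. cone_angle F \<Theta> (\<rho> n) v) \<longlonglongrightarrow> angle_sup F \<Theta> A"
    if "\<And>n. \<forall>w\<in>V. \<rho> n w > 0" "\<forall>w\<in>V. (\<lambda>n. \<rho> n w) \<longlonglongrightarrow> r w" "A \<subset> V" "\<forall>w\<in>A. r w = 0" "\<forall>w\<in>V - A. r w > 0"
    for \<rho> r A
  proof -
    have "A \<subseteq> V" using that(3) by auto
    then show ?thesis unfolding cone_angle_sum[OF \<open>A \<subseteq> V\<close>] angle_sup_def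
      using that by (intro tendsto_sum tri_angle_degenerate) auto
  qed
qed

text \<open>Source of the upper bounds on the individual curvatures: every vertex lies in a
  triangle, where its angle is positive.\<close>

lemma cone_angle_pos:
  assumes "\<forall>w\<in>V. r w > 0" "v \<in> V"
  shows "0 < cone_angle F \<Theta> r v"
  unfolding cone_angle_def
proof (rule sum_pos)
  show "finite {t \<in> F. v \<in> t}" using F_finite by simp
  show "{t \<in> F. v \<in> t} \<noteq> {}" using assms(2) V_Union by auto
qed (use assms tri_angle_pos in auto)

section \<open>Euler characteristics and the combinatorial form of the bound\<close>

lemma edges_finite: "finite (edges F)"
proof (rule finite_subset)
  show "edges F \<subseteq> Pow V" using tri_subset by (fastforce simp: edges_def)
qed (use V_finite in simp)

lemma bdry_edges_subset: "bdry_edges F \<subseteq> edges F"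
  by (auto simp: bdry_edges_def)

lemma bdry_verts_subset: "bdry_verts F \<subseteq> V"
  using tri_subset by (fastforce simp: bdry_verts_def bdry_edges_def edges_def)

text \<open>Counted as the three edges minus those avoiding \<open>A\<close>. The values 0, 2, 3, 3
  for 0 to 3 vertices in \<open>A\<close> are written with indicators so that they can be summed
  over \<open>F\<close>.\<close>

lemma tri_edges_meeting:
  assumes "t \<in> F"
  shows "card {e \<in> edges F. e \<inter> A \<noteq> {} \<and> e \<subseteq> t} =
    2 * of_bool (t \<inter> A \<noteq> {}) + of_bool (card (t \<inter> A) \<ge> 2)"
proof -
  note fin = tri_finite[OF assms]
  have split: "card (t \<inter> A) + card (t - A) = 3"
    using card_Int_Diff[OF fin, of A] tri_card[OF assms] by simp
  have "{e \<in> edges F. e \<inter> A \<noteq> {} \<and> e \<subseteq> t} = {e. e \<subseteq> t \<and> card e = 2} - {e. e \<subseteq> t - A \<and> card e = 2}"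
    unfolding edges_def using assms by blast
  moreover have "finite {e. e \<subseteq> t - A \<and> card e = 2}"
    by (rule finite_subset[of _ "Pow t"], blast) (simp add: fin)
  then have "card ({e. e \<subseteq> t \<and> card e = 2} - {e. e \<subseteq> t - A \<and> card e = 2}) =
      card {e. e \<subseteq> t \<and> card e = 2} - card {e. e \<subseteq> t - A \<and> card e = 2}"
    by (rule card_Diff_subset) blast
  ultimately have "card {e \<in> edges F. e \<inter> A \<noteq> {} \<and> e \<subseteq> t} = (card t choose 2) - (card (t - A) choose 2)"
    using fin by (simp only: n_subsets finite_Diff)
  also have "\<dots> = 3 - (card (t - A) choose 2)"
    by (simp add: tri_card[OF assms] choose_two)
  also have "\<dots> = 2 * of_bool (card (t \<inter> A) \<noteq> 0) + of_bool (card (t \<inter> A) \<ge> 2)"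
  proof -
    have "card (t - A) = 3 - card (t \<inter> A)" "card (t \<inter> A) \<le> 3" using split by simp_all
    then consider "card (t - A) = 3" "card (t \<inter> A) = 0" | "card (t - A) = 2" "card (t \<inter> A) = 1"
      | "card (t - A) = 1" "card (t \<inter> A) = 2" | "card (t - A) = 0" "card (t \<inter> A) = 3"
      by (auto simp: le_Suc_eq numeral_3_eq_3)
    then show ?thesis by cases (simp_all add: choose_two)
  qed
  finally show ?thesis using fin by simp
qed

text \<open>Double counting of the pairs \<open>e \<subset> t\<close> with \<open>e\<close> meeting \<open>A\<close>.\<close>

lemma edge_count:
  "2 * card {e \<in> edges F - bdry_edges F. e \<inter> A \<noteq> {}} + card {e \<in> bdry_edges F. e \<inter> A \<noteq> {}} =
    2 * card {t \<in> F. t \<inter> A \<noteq> {}} + card {t \<in> F. card (t \<inter> A) \<ge> 2}"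
proof -
  let ?E = "{e \<in> edges F. e \<inter> A \<noteq> {}}"
  let ?I = "{e \<in> edges F - bdry_edges F. e \<inter> A \<noteq> {}}" and ?B = "{e \<in> bdry_edges F. e \<inter> A \<noteq> {}}"
  have fin: "finite ?E" "finite ?I" "finite ?B"
    using edges_finite finite_subset[OF bdry_edges_subset] by auto
  have "(\<Sum>e\<in>?E. card {t \<in> F. e \<subseteq> t}) = (\<Sum>e\<in>?E. \<Sum>t\<in>{t \<in> F. e \<subseteq> t}. 1)" by simp
  also have "\<dots> = (\<Sum>t\<in>F. \<Sum>e\<in>{e \<in> ?E. e \<subseteq> t}. 1)"
    using fin(1) F_finite by (rule sum.swap_restrict)
  also have "\<dots> = (\<Sum>t\<in>F. 2 * of_bool (t \<inter> A \<noteq> {}) + of_bool (card (t \<inter> A) \<ge> 2))"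
    by (intro sum.cong refl) (simp add: tri_edges_meeting conj_assoc)
  also have "\<dots> = 2 * card {t \<in> F. t \<inter> A \<noteq> {}} + card {t \<in> F. card (t \<inter> A) \<ge> 2}"
    using F_finite by (simp add: sum.distrib sum_distrib_left[symmetric] sum_of_bool_eq Int_def)
  finally have 1: "(\<Sum>e\<in>?E. card {t \<in> F. e \<subseteq> t}) =
    2 * card {t \<in> F. t \<inter> A \<noteq> {}} + card {t \<in> F. card (t \<inter> A) \<ge> 2}" .
  have "?E = ?I \<union> ?B" using bdry_edges_subset by auto
  then have "(\<Sum>e\<in>?E. card {t \<in> F. e \<subseteq> t}) = (\<Sum>e\<in>?I. card {t \<in> F. e \<subseteq> t}) + (\<Sum>e\<in>?B. card {t \<in> F. e \<subseteq> t})"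
    using fin by (simp add: sum.union_disjoint disjoint_iff)
  also have "(\<Sum>e\<in>?I. card {t \<in> F. e \<subseteq> t}) = (\<Sum>e\<in>?I. 2)"
    using tri by (intro sum.cong) (auto simp: surface_triangulation_def bdry_edges_def)
  also have "(\<Sum>e\<in>?B. card {t \<in> F. e \<subseteq> t}) = (\<Sum>e\<in>?B. 1)"
    by (intro sum.cong) (auto simp: bdry_edges_def)
  finally show ?thesis using 1 by simp
qed

text \<open>A triangle with exactly one vertex in \<open>A\<close> is the same as a pair of that
  vertex and its opposite edge.\<close>

lemma sum_Lk:
  "(\<Sum>p\<in>Lk F A. pi - \<Theta> (fst p)) = (\<Sum>t\<in>{t \<in> F. card (t \<inter> A) = 1}. pi - \<Theta> (t - A))"
proof (rule sum.reindex_bij_witness[of _ "\<lambda>t. (t - A, the_elem (t \<inter> A))" "\<lambda>p. insert (snd p) (fst p)"])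
  fix p assume p: "p \<in> Lk F A"
  obtain e v where ev: "p = (e, v)" by (cases p)
  have *: "v \<in> A" "e \<in> edges F" "e \<inter> A = {}" "insert v e \<in> F" using p by (auto simp: Lk_def ev)
  then have "insert v e \<inter> A = {v}" "insert v e - A = e" by auto
  then show "(insert (snd p) (fst p) - A, the_elem (insert (snd p) (fst p) \<inter> A)) = p"
    "insert (snd p) (fst p) \<in> {t \<in> F. card (t \<inter> A) = 1}"
    "pi - \<Theta> (insert (snd p) (fst p) - A) = pi - \<Theta> (fst p)"
    using * by (simp_all add: ev)
next
  fix t assume t: "t \<in> {t \<in> F. card (t \<inter> A) = 1}"
  then obtain v where v: "t \<inter> A = {v}" by (auto simp: card_1_singleton_iff)
  then have ins: "insert v (t - A) = t" by auto
  then show "insert (snd (t - A, the_elem (t \<inter> A))) (fst (t - A, the_elem (t \<inter> A))) = t" using v by simp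
  have "card (t - A) = 2"
    using card_Int_Diff[of t A] tri_finite[of t] tri_card[of t] t by simp
  then have "t - A \<in> edges F" using t by (auto simp: edges_def)
  then show "(t - A, the_elem (t \<inter> A)) \<in> Lk F A" using v ins t by (auto simp: Lk_def)
qed

lemma angle_sup_eq:
  "angle_sup F \<Theta> A = pi * card {t \<in> F. card (t \<inter> A) \<ge> 2} + (\<Sum>p\<in>Lk F A. pi - \<Theta> (fst p))"
proof -
  have "tri_sup \<Theta> A t = (if card (t \<inter> A) \<ge> 2 then pi else 0) + (if card (t \<inter> A) = 1 then pi - \<Theta> (t - A) else 0)"
    if t: "t \<in> F" for t
  proof -
    consider "t \<inter> A = {}" | "card (t \<inter> A) = 1" | "card (t \<inter> A) \<ge> 2"
      using card_0_eq[of "t \<inter> A"] tri_finite[OF t] by (cases "card (t \<inter> A) = 0") force+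
    then show ?thesis by cases (auto simp: tri_sup_def)
  qed
  then have "angle_sup F \<Theta> A = (\<Sum>t\<in>F. if card (t \<inter> A) \<ge> 2 then pi else 0) +
      (\<Sum>t\<in>F. if card (t \<inter> A) = 1 then pi - \<Theta> (t - A) else 0)"
    by (simp add: angle_sup_def sum.distrib)
  then show ?thesis
    using F_finite by (simp add: sum_Lk sum.inter_filter[symmetric])
qed

definition flat_angle :: "'v \<Rightarrow> real" where
  "flat_angle v = (if v \<in> bdry_verts F then pi else 2 * pi)"

text \<open>The vertex terms give the flat angles. By \<open>edge_count\<close>, weight 2 on
  interior and 1 on boundary edges cancels the triangles meeting \<open>A\<close> and leaves -pi for
  each triangle with at least two vertices in \<open>A\<close>, matching
  \<open>angle_sup_eq\<close>.\<close>

lemma rhs_eq: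
  assumes "A \<subseteq> V"
  shows "- (\<Sum>p\<in>Lk F A. pi - \<Theta> (fst p)) + 2 * pi * real_of_int (chi_int F A)
      + pi * real_of_int (chi_bdry F A) = (\<Sum>v\<in>A. flat_angle v) - angle_sup F \<Theta> A"
proof -
  have fin: "finite A" using assms V_finite finite_subset by blast
  let ?I = "{e \<in> edges F - bdry_edges F. e \<inter> A \<noteq> {}}" and ?B = "{e \<in> bdry_edges F. e \<inter> A \<noteq> {}}"
  let ?T = "{t \<in> F. t \<inter> A \<noteq> {}}" and ?N = "{t \<in> F. card (t \<inter> A) \<ge> 2}"
  have "(\<Sum>v\<in>A. flat_angle v) = (\<Sum>v\<in>A \<inter> bdry_verts F. flat_angle v) + (\<Sum>v\<in>A - bdry_verts F. flat_angle v)"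
    using fin by (rule sum.Int_Diff)
  then have flat: "(\<Sum>v\<in>A. flat_angle v) = pi * card (A \<inter> bdry_verts F) + 2 * pi * card (A - bdry_verts F)"
    by (simp add: flat_angle_def)
  have "real (2 * card ?I + card ?B) = real (2 * card ?T + card ?N)" by (simp only: edge_count)
  then have "pi * (2 * real (card ?I) + real (card ?B)) = pi * (2 * real (card ?T) + real (card ?N))" by simp
  then show ?thesis
    unfolding flat angle_sup_eq chi_int_def chi_bdry_def by (simp add: algebra_simps)
qed

end

section \<open>Curvatures in place of cone angles\<close>

theorem theorem0p5:
  fixes V :: "'v set" and F :: "'v set set" and \<Theta> :: "'v set \<Rightarrow> real"
  assumes tri: "surface_triangulation V F"
    and Theta_range: "\<forall>e\<in>edges F. 0 \<le> \<Theta> e \<and> \<Theta> e < pi"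
    and C1: "cond_C1 F \<Theta>"
  shows "(\<forall>r r'. (\<forall>v\<in>V. r v > 0) \<longrightarrow> (\<forall>v\<in>V. r' v > 0) \<longrightarrow>
            (\<forall>v\<in>V. Th F \<Theta> r v = Th F \<Theta> r' v) \<longrightarrow>
            (\<exists>c>0. \<forall>v\<in>V. r' v = c * r v))
       \<and> (\<forall>K :: 'v \<Rightarrow> real.
            (\<exists>r. (\<forall>v\<in>V. r v > 0) \<and> (\<forall>v\<in>V. Th F \<Theta> r v = K v)) \<longleftrightarrow>
            ((\<forall>v\<in>V - bdry_verts F. K v < 2 * pi) \<and> (\<forall>v\<in>bdry_verts F. K v < pi) \<and>
             (\<forall>A. A \<subseteq> V \<longrightarrow> A \<noteq> {} \<longrightarrow>
                (let rhs = - (\<Sum>p\<in>Lk F A. pi - \<Theta> (fst p))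
                           + 2 * pi * real_of_int (chi_int F A)
                           + pi * real_of_int (chi_bdry F A)
                 in (\<Sum>v\<in>A. K v) \<ge> rhs \<and> ((\<Sum>v\<in>A. K v) = rhs \<longleftrightarrow> A = V)))))"
proof -
  interpret weighted_triangulation V F \<Theta> by standard (fact assms)+
  have Th: "Th F \<Theta> r v = flat_angle v - cone_angle F \<Theta> r v" for r v
    by (simp add: Th_def flat_angle_def)
  have inj: "\<exists>c>0. \<forall>v\<in>V. r' v = c * r v"
    if "\<forall>v\<in>V. r v > 0" "\<forall>v\<in>V. r' v > 0" "\<forall>v\<in>V. Th F \<Theta> r v = Th F \<Theta> r' v" for r r'
    using rigidity[OF that(1,2)] that(3) by (simp add: Th)
  have img: "(\<exists>r. pos r \<and> (\<forall>v\<in>V. Th F \<Theta> r v = K v)) \<longleftrightarrow>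
      (\<forall>v\<in>V - bdry_verts F. K v < 2 * pi) \<and> (\<forall>v\<in>bdry_verts F. K v < pi) \<and>
      (\<forall>A. A \<subseteq> V \<longrightarrow> A \<noteq> {} \<longrightarrow> (let rhs = (\<Sum>v\<in>A. flat_angle v) - angle_sup F \<Theta> A
         in (\<Sum>v\<in>A. K v) \<ge> rhs \<and> ((\<Sum>v\<in>A. K v) = rhs \<longleftrightarrow> A = V)))"
    (is "?L \<longleftrightarrow> ?bounds1 \<and> ?bounds2 \<and> ?sums") for K
  proof -
    have "?L \<longleftrightarrow> (\<exists>r. pos r \<and> (\<forall>v\<in>V. cone_angle F \<Theta> r v = flat_angle v - K v))"
      by (simp add: Th algebra_simps eq_commute)
    also have "\<dots> \<longleftrightarrow> (\<Sum>v\<in>V. flat_angle v - K v) = angle_sup F \<Theta> V \<and>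
        (\<forall>A. A \<subset> V \<longrightarrow> A \<noteq> {} \<longrightarrow> (\<Sum>v\<in>A. flat_angle v - K v) < angle_sup F \<Theta> A)"
      by (rule image)
    \<comment> \<open>A lower bound attained exactly for \<open>A = V\<close> is the identity at
      \<open>V\<close> together with strictness on proper subsets; the direction flips because
      curvature is flat angle minus cone angle.\<close>
    also have "\<dots> \<longleftrightarrow> ?sums"
    proof (intro iffI allI impI conjI)
      fix A
      assume *: "(\<Sum>v\<in>V. flat_angle v - K v) = angle_sup F \<Theta> V \<and>
        (\<forall>A. A \<subset> V \<longrightarrow> A \<noteq> {} \<longrightarrow> (\<Sum>v\<in>A. flat_angle v - K v) < angle_sup F \<Theta> A)" and "A \<subseteq> V" "A \<noteq> {}"
      show "let rhs = (\<Sum>v\<in>A. flat_angle v) - angle_sup F \<Theta> A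
         in (\<Sum>v\<in>A. K v) \<ge> rhs \<and> ((\<Sum>v\<in>A. K v) = rhs \<longleftrightarrow> A = V)"
      proof (cases "A = V")
        case True
        then show ?thesis using * by (simp add: Let_def sum_subtractf algebra_simps)
      next
        case False
        then have "(\<Sum>v\<in>A. flat_angle v - K v) < angle_sup F \<Theta> A"
          using * \<open>A \<subseteq> V\<close> \<open>A \<noteq> {}\<close> by blast
        then show ?thesis using False by (simp add: Let_def sum_subtractf)
      qed
    next
      assume ?sums
      then show "(\<Sum>v\<in>V. flat_angle v - K v) = angle_sup F \<Theta> V"
        using V_nonempty by (auto simp: Let_def sum_subtractf)
    next
      fix A assume "?sums" "A \<subset> V" "A \<noteq> {}"
      then have "(\<Sum>v\<in>A. K v) \<ge> (\<Sum>v\<in>A. flat_angle v) - angle_sup F \<Theta> A"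
        "(\<Sum>v\<in>A. K v) \<noteq> (\<Sum>v\<in>A. flat_angle v) - angle_sup F \<Theta> A"
        unfolding Let_def by blast+
      then show "(\<Sum>v\<in>A. flat_angle v - K v) < angle_sup F \<Theta> A"
        by (simp add: sum_subtractf)
    qed
    finally have "?L \<longleftrightarrow> ?sums" .
    moreover have "?bounds1 \<and> ?bounds2" if ?L
    proof -
      have "K v < flat_angle v" if "v \<in> V" for v
        using \<open>?L\<close> cone_angle_pos that by (force simp: Th)
      then show ?thesis using bdry_verts_subset by (force simp: flat_angle_def)
    qed
    ultimately show ?thesis by blast
  qed
  show ?thesis
  proof (intro conjI allI impI, goal_cases)
    case (1 r r')
    then show ?case by (rule inj)
  next
    case (2 K)
    show ?case using img[of K] by (simp only: rhs_eq cong: imp_cong)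
  qed
qed

end
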